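(* Let $n\ge 1$ and let $\varphi$ be a holomorphic automorphism of the unit ball $\mathbb{B}_n$ of $\mathbb{C}^n$ with a fixed point $a\in\mathbb{B}_n$. Then the following statements are equivalent. (i) $C_\varphi$ is mean ergodic on $H^\infty(\mathbb{B}_n)$. (ii) $C_\varphi$ is uniformly mean ergodic on $H^\infty(\mathbb{B}_n)$. (iii) $\mathrm{sp}\, d_a\varphi\subset\{\lambda\in\partial\mathbb{D}:\ \lambda \text{ is a root of } 1\}$.
   Context: $\mathbb{B}_n=\{z\in\mathbb{C}^n: |z|<1\}$ is the open Euclidean unit ball, $\mathbb{D}=\mathbb{B}_1$. $H^\infty(\mathbb{B}_n)$ is the Banach space of bounded holomorphic functions $f:\mathbb{B}_n\to\mathbb{C}$ with the supremum norm. For a holomorphic self-map $\varphi$ of $\mathbb{B}_n$, $C_\varphi f=f\circ\varphi$. For a bounded operator $T$ on a Banach space $X$, let $M_j(T)=\frac1j\sum_{i=1}^j T^i$; $T$ is mean ergodic if $M_j(T)$ converges in the strong operator topology to a bounded operator on $X$, and uniformly mean ergodic if $M_j(T)$ converges in operator norm. $d_a\varphi=\varphi'(a)$ is the complex derivative of $\varphi$ at $a$ (an $n\times n$ matrix) and $\mathrm{sp}$ denotes the spectrum (set of eigenvalues). "Root of $1$" means $\lambda^m=1$ for some integer $m\ge1$. *)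

theory Defs
  imports "HOL-Analysis.Analysis"
begin

section \<open>Holomorphic functions of several complex variables\<close>

text \<open>The norm of \<^typ>\<open>complex^'n\<close> is the Euclidean one, so the open unit ball
  of \<open>C\<^sup>n\<close> with \<open>n = CARD('n)\<close> is \<open>ball 0 1\<close>; \<open>n\<close> is at least 1 because types are nonempty.\<close>

abbreviation unit_ball :: "(complex^'n) set"
  where "unit_ball \<equiv> ball 0 1"

text \<open>Meant for open \<open>S\<close>: a complex linear Frechet derivative exists at every point of \<open>S\<close>.\<close>

definition mv_holomorphic_on :: "(complex^'n \<Rightarrow> complex) \<Rightarrow> (complex^'n) set \<Rightarrow> bool"
  where "mv_holomorphic_on f S \<longleftrightarrow>
    (\<forall>z\<in>S. \<exists>D. (f has_derivative D) (at z) \<and> (\<forall>c h. D (c *s h) = c * D h))"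

definition holomorphic_map_on :: "(complex^'n \<Rightarrow> complex^'m) \<Rightarrow> (complex^'n) set \<Rightarrow> bool"
  where "holomorphic_map_on F S \<longleftrightarrow> (\<forall>i. mv_holomorphic_on (\<lambda>z. F z $ i) S)"

definition ball_self_map :: "(complex^'n \<Rightarrow> complex^'n) \<Rightarrow> bool"
  where "ball_self_map \<phi> \<longleftrightarrow> holomorphic_map_on \<phi> unit_ball \<and> \<phi> ` unit_ball \<subseteq> unit_ball"

lemma ball_self_mapD: "ball_self_map \<phi> \<Longrightarrow> z \<in> unit_ball \<Longrightarrow> \<phi> z \<in> unit_ball"
  unfolding ball_self_map_def by blast

definition ball_automorphism :: "(complex^'n \<Rightarrow> complex^'n) \<Rightarrow> bool"
  where "ball_automorphism \<phi> \<longleftrightarrow> ball_self_map \<phi> \<and>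
    (\<exists>\<psi>. ball_self_map \<psi> \<and> (\<forall>z\<in>unit_ball. \<psi> (\<phi> z) = z \<and> \<phi> (\<psi> z) = z))"

definition eigenvalues :: "complex^'n^'n \<Rightarrow> complex set"
  where "eigenvalues A = {\<mu>. \<exists>v. v \<noteq> 0 \<and> A *v v = \<mu> *s v}"

lemma holomorphic_map_on_has_derivative:
  assumes "holomorphic_map_on F S" "z \<in> S"
  obtains D where "(F has_derivative D) (at z)" "\<And>c h. D (c *s h) = c *s D h"
proof -
  have "\<forall>i. \<exists>D. ((\<lambda>z. F z $ i) has_derivative D) (at z) \<and> (\<forall>c h. D (c *s h) = c * D h)"
    using assms by (auto simp: holomorphic_map_on_def mv_holomorphic_on_def)
  then obtain D where D: "\<And>i. ((\<lambda>z. F z $ i) has_derivative D i) (at z)"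
    "\<And>i c h. D i (c *s h) = c * D i h" by metis
  have "(F has_derivative (\<lambda>h. \<chi> i. D i h)) (at z)"
    by (subst has_derivative_componentwise_within)
      (auto simp: Basis_vec_def inner_axis intro!: has_derivative_inner_left D(1))
  then show ?thesis
    by (intro that[of "\<lambda>h. \<chi> i. D i h"]) (auto simp: D(2) vec_eq_iff)
qed

text \<open>Although a Frechet derivative is a priori only real linear, for holomorphic maps the library's
  \<^const>\<open>jacobian\<close> is the complex derivative matrix.\<close>

lemma has_derivative_jacobian:
  assumes "holomorphic_map_on F S" "z \<in> S"
  shows "(F has_derivative (\<lambda>h. jacobian F (at z) *v h)) (at z)"
proof -
  obtain D where D: "(F has_derivative D) (at z)" "\<And>c h. D (c *s h) = c *s D h"
    using holomorphic_map_on_has_derivative[OF assms] by metis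
  have "Vector_Spaces.linear (*s) (*s) D"
    using D(2) linear_add[OF has_derivative_linear[OF D(1)]]
    by unfold_locales (auto simp: vector_add_ldistrib)
  then have "matrix D *v h = D h" for h by (rule matrix_works)
  then show ?thesis
    using D(1) frechet_derivative_at[OF D(1)] by (simp add: jacobian_def)
qed

section \<open>The space of bounded holomorphic functions on the ball\<close>

text \<open>Functions are total, so the value outside the ball is normalised to \<open>0\<close>.\<close>

typedef 'n hinf = "{f :: complex^'n::finite \<Rightarrow> complex.
    mv_holomorphic_on f unit_ball \<and> bounded (f ` unit_ball) \<and> (\<forall>z. z \<notin> unit_ball \<longrightarrow> f z = 0)}"
  morphisms hinf_apply Hinf
proof
  show "(\<lambda>_. 0) \<in> {f :: complex^'n \<Rightarrow> complex.
    mv_holomorphic_on f unit_ball \<and> bounded (f ` unit_ball) \<and> (\<forall>z. z \<notin> unit_ball \<longrightarrow> f z = 0)}"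
    by (auto simp: mv_holomorphic_on_def bounded_iff intro!: exI[of _ "\<lambda>_. 0"] exI[of _ 0])
qed

setup_lifting type_definition_hinf

lemma hinf_eqI: "(\<And>z. z \<in> unit_ball \<Longrightarrow> hinf_apply f z = hinf_apply g z) \<Longrightarrow> f = g"
  by transfer fastforce

lemma bounded_hinf_apply: "bounded (hinf_apply f ` unit_ball)"
  by transfer simp

lemma mv_holomorphic_hinf_apply: "mv_holomorphic_on (hinf_apply f) unit_ball"
  by transfer simp

lemma hinf_apply_outside: "z \<notin> unit_ball \<Longrightarrow> hinf_apply f z = 0"
  by transfer simp

lemma mv_holomorphic_on_add:
  assumes "mv_holomorphic_on f S" "mv_holomorphic_on g S"
  shows "mv_holomorphic_on (\<lambda>z. f z + g z) S"
  unfolding mv_holomorphic_on_def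
proof
  fix z assume "z \<in> S"
  with assms obtain D E
    where "(f has_derivative D) (at z)" "\<forall>c h. D (c *s h) = c * D h"
      and "(g has_derivative E) (at z)" "\<forall>c h. E (c *s h) = c * E h"
    unfolding mv_holomorphic_on_def by metis
  then show "\<exists>D. ((\<lambda>z. f z + g z) has_derivative D) (at z) \<and> (\<forall>c h. D (c *s h) = c * D h)"
    by (intro exI[of _ "\<lambda>h. D h + E h"]) (auto intro!: derivative_intros simp: algebra_simps)
qed

lemma mv_holomorphic_on_cmult:
  assumes "mv_holomorphic_on f S"
  shows "mv_holomorphic_on (\<lambda>z. k * f z) S"
  unfolding mv_holomorphic_on_def
proof
  fix z assume "z \<in> S"
  with assms obtain D where "(f has_derivative D) (at z)" "\<forall>c h. D (c *s h) = c * D h"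
    unfolding mv_holomorphic_on_def by metis
  then show "\<exists>D. ((\<lambda>z. k * f z) has_derivative D) (at z) \<and> (\<forall>c h. D (c *s h) = c * D h)"
    by (intro exI[of _ "\<lambda>h. k * D h"]) (auto intro!: derivative_eq_intros simp: algebra_simps)
qed

lemma bounded_image_cmult:
  fixes f :: "'b \<Rightarrow> complex"
  assumes "bounded (f ` S)" shows "bounded ((\<lambda>z. k * f z) ` S)"
  using bounded_linear_image[OF assms bounded_linear_mult_right[of k]] by (simp add: image_image)

instantiation hinf :: (finite) real_vector
begin

lift_definition zero_hinf :: "'a hinf" is "\<lambda>_. 0"
  by (auto simp: mv_holomorphic_on_def bounded_iff intro!: exI[of _ "\<lambda>_. 0"] exI[of _ 0])

lift_definition plus_hinf :: "'a hinf \<Rightarrow> 'a hinf \<Rightarrow> 'a hinf" is "\<lambda>f g z. f z + g z"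
  by (simp add: mv_holomorphic_on_add bounded_plus_comp)

lift_definition uminus_hinf :: "'a hinf \<Rightarrow> 'a hinf" is "\<lambda>f z. - f z"
proof -
  fix f :: "complex^'a \<Rightarrow> complex"
  assume "mv_holomorphic_on f unit_ball \<and> bounded (f ` unit_ball) \<and>
    (\<forall>z. z \<notin> unit_ball \<longrightarrow> f z = 0)"
  then show "mv_holomorphic_on (\<lambda>z. - f z) unit_ball \<and> bounded ((\<lambda>z. - f z) ` unit_ball) \<and>
    (\<forall>z. z \<notin> unit_ball \<longrightarrow> - f z = 0)"
    using mv_holomorphic_on_cmult[of f unit_ball "-1"] bounded_image_cmult[of f unit_ball "-1"]
    by simp
qed

lift_definition minus_hinf :: "'a hinf \<Rightarrow> 'a hinf \<Rightarrow> 'a hinf" is "\<lambda>f g z. f z - g z"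
proof -
  fix f g :: "complex^'a \<Rightarrow> complex"
  assume "mv_holomorphic_on f unit_ball \<and> bounded (f ` unit_ball) \<and>
      (\<forall>z. z \<notin> unit_ball \<longrightarrow> f z = 0)"
    and "mv_holomorphic_on g unit_ball \<and> bounded (g ` unit_ball) \<and>
      (\<forall>z. z \<notin> unit_ball \<longrightarrow> g z = 0)"
  then show "mv_holomorphic_on (\<lambda>z. f z - g z) unit_ball \<and>
    bounded ((\<lambda>z. f z - g z) ` unit_ball) \<and> (\<forall>z. z \<notin> unit_ball \<longrightarrow> f z - g z = 0)"
    using mv_holomorphic_on_add[of f unit_ball "\<lambda>z. - 1 * g z"]
      mv_holomorphic_on_cmult[of g unit_ball "-1"] bounded_minus_comp[of f unit_ball g]
    by simp
qed

lift_definition scaleR_hinf :: "real \<Rightarrow> 'a hinf \<Rightarrow> 'a hinf" is "\<lambda>r f z. r *\<^sub>R f z"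
  by (simp add: scaleR_conv_of_real mv_holomorphic_on_cmult bounded_image_cmult)

instance
  by standard (transfer; simp add: fun_eq_iff algebra_simps)+

end

instantiation hinf :: (finite) real_normed_vector
begin

definition norm_hinf :: "'a hinf \<Rightarrow> real"
  where "norm_hinf f = (SUP z\<in>unit_ball. norm (hinf_apply f z))"

definition dist_hinf :: "'a hinf \<Rightarrow> 'a hinf \<Rightarrow> real"
  where "dist_hinf f g = norm (f - g)"

definition sgn_hinf :: "'a hinf \<Rightarrow> 'a hinf"
  where "sgn_hinf f = f /\<^sub>R norm f"

definition uniformity_hinf :: "('a hinf \<times> 'a hinf) filter"
  where "uniformity_hinf = (INF e\<in>{0<..}. principal {(f, g). dist f g < e})"

definition open_hinf :: "'a hinf set \<Rightarrow> bool"
  where "open_hinf U = (\<forall>f\<in>U. \<forall>\<^sub>F (f', g) in uniformity. f' = f \<longrightarrow> g \<in> U)"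

lemma bdd_above_hinf: "bdd_above ((\<lambda>z. norm (hinf_apply f z)) ` unit_ball)"
  using bounded_hinf_apply[of f] unfolding bounded_iff bdd_above_def by auto

lemma norm_hinf_apply_le: "z \<in> unit_ball \<Longrightarrow> norm (hinf_apply f z) \<le> norm f"
  unfolding norm_hinf_def by (rule cSUP_upper[OF _ bdd_above_hinf])

lemma norm_hinf_leI: "(\<And>z. z \<in> unit_ball \<Longrightarrow> norm (hinf_apply f z) \<le> B) \<Longrightarrow> norm f \<le> B"
  unfolding norm_hinf_def by (rule cSUP_least) auto

instance
proof
  fix f g :: "'a hinf" and r :: real
  have nonneg: "0 \<le> norm h" for h :: "'a hinf"
    using norm_hinf_apply_le[of 0 h] by (auto intro: order_trans[OF norm_ge_zero])
  show "norm f = 0 \<longleftrightarrow> f = 0"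
  proof
    assume "norm f = 0"
    then show "f = 0"
      using norm_hinf_apply_le[of _ f] by (intro hinf_eqI) (auto simp: zero_hinf.rep_eq)
  qed (simp add: norm_hinf_def zero_hinf.rep_eq)
  show "norm (f + g) \<le> norm f + norm g"
    by (rule norm_hinf_leI)
      (auto simp: plus_hinf.rep_eq intro!: norm_triangle_le add_mono norm_hinf_apply_le)
  have le: "norm (s *\<^sub>R h) \<le> \<bar>s\<bar> * norm h" for s and h :: "'a hinf"
    by (rule norm_hinf_leI) (auto simp: scaleR_hinf.rep_eq intro!: mult_left_mono norm_hinf_apply_le)
  show "norm (r *\<^sub>R f) = \<bar>r\<bar> * norm f"
  proof (cases "r = 0")
    case True
    then show ?thesis by (simp add: norm_hinf_def zero_hinf.rep_eq)
  next
    case False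
    then have "norm f \<le> \<bar>inverse r\<bar> * norm (r *\<^sub>R f)"
      using le[of "inverse r" "r *\<^sub>R f"] by simp
    with False have "\<bar>r\<bar> * norm f \<le> norm (r *\<^sub>R f)" by (simp add: field_simps)
    with le[of r f] show ?thesis by simp
  qed
qed (simp_all add: dist_hinf_def sgn_hinf_def uniformity_hinf_def open_hinf_def)

end

section \<open>Composition operators and mean ergodicity\<close>

text \<open>Meaningful for holomorphic self-maps \<open>\<phi>\<close> of the ball, see \<open>comp_operator_apply\<close> below.\<close>

definition comp_operator :: "(complex^'n \<Rightarrow> complex^'n) \<Rightarrow> 'n::finite hinf \<Rightarrow>\<^sub>L 'n hinf"
  where "comp_operator \<phi> = Blinfun (\<lambda>f. Hinf (\<lambda>z. if z \<in> unit_ball then hinf_apply f (\<phi> z) else 0))"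

text \<open>The type \<open>'a \<Rightarrow>\<^sub>L 'a\<close> consists of the bounded real linear operators. For a complex linear \<open>T\<close>
  (such as a composition operator) the means, and hence their strong limit \<open>P\<close>, are again complex
  linear, so nothing changes by not demanding this of \<open>P\<close>. The junk value at \<open>j = 0\<close> is \<open>0\<close>.\<close>

definition cesaro_mean :: "nat \<Rightarrow> ('a::real_normed_vector \<Rightarrow>\<^sub>L 'a) \<Rightarrow> ('a \<Rightarrow>\<^sub>L 'a)"
  where "cesaro_mean j T = (1 / real j) *\<^sub>R (\<Sum>i=1..j. (((o\<^sub>L) T) ^^ i) id_blinfun)"

definition mean_ergodic :: "('a::real_normed_vector \<Rightarrow>\<^sub>L 'a) \<Rightarrow> bool"
  where "mean_ergodic T \<longleftrightarrow>
    (\<exists>P :: 'a \<Rightarrow>\<^sub>L 'a. \<forall>x. (\<lambda>j. blinfun_apply (cesaro_mean j T) x) \<longlonglongrightarrow> blinfun_apply P x)"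

definition uniformly_mean_ergodic :: "('a::real_normed_vector \<Rightarrow>\<^sub>L 'a) \<Rightarrow> bool"
  where "uniformly_mean_ergodic T \<longleftrightarrow> convergent (\<lambda>j. cesaro_mean j T)"

lemma mv_holomorphic_on_compose:
  assumes f: "mv_holomorphic_on f unit_ball" and \<phi>: "ball_self_map \<phi>"
  shows "mv_holomorphic_on (\<lambda>z. if z \<in> unit_ball then f (\<phi> z) else 0) unit_ball"
  unfolding mv_holomorphic_on_def
proof
  fix z :: "complex^'a" assume z: "z \<in> unit_ball"
  obtain E where E: "(\<phi> has_derivative E) (at z)" "\<And>c h. E (c *s h) = c *s E h"
    using holomorphic_map_on_has_derivative[of \<phi> unit_ball z] \<phi> z
    unfolding ball_self_map_def by metis
  have "\<phi> z \<in> unit_ball" by (rule ball_self_mapD[OF \<phi> z])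
  with f obtain D where D: "(f has_derivative D) (at (\<phi> z))" "\<forall>c h. D (c *s h) = c * D h"
    unfolding mv_holomorphic_on_def by metis
  have "((\<lambda>z. f (\<phi> z)) has_derivative (\<lambda>h. D (E h))) (at z)"
    using has_derivative_compose[OF E(1) D(1)] .
  then have "((\<lambda>z. if z \<in> unit_ball then f (\<phi> z) else 0) has_derivative (\<lambda>h. D (E h))) (at z)"
    by (rule has_derivative_transform_within_open[of _ _ _ _ unit_ball]) (use z in auto)
  then show "\<exists>D. ((\<lambda>z. if z \<in> unit_ball then f (\<phi> z) else 0) has_derivative D) (at z)
      \<and> (\<forall>c h. D (c *s h) = c * D h)"
    using D(2) E(2) by (intro exI[of _ "\<lambda>h. D (E h)"]) auto
qed

lemma comp_operator_apply:
  assumes \<phi>: "ball_self_map \<phi>" and z: "z \<in> unit_ball"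
  shows "hinf_apply (blinfun_apply (comp_operator \<phi>) f) z = hinf_apply f (\<phi> z)"
proof -
  define C where "C = (\<lambda>f. Hinf (\<lambda>z. if z \<in> unit_ball then hinf_apply f (\<phi> z) else 0))"
  have ball: "\<phi> w \<in> unit_ball" if "w \<in> unit_ball" for w
    by (rule ball_self_mapD[OF \<phi> that])
  have C: "hinf_apply (C g) = (\<lambda>z. if z \<in> unit_ball then hinf_apply g (\<phi> z) else 0)" for g
    unfolding C_def
  proof (rule Hinf_inverse, safe)
    show "mv_holomorphic_on (\<lambda>z. if z \<in> unit_ball then hinf_apply g (\<phi> z) else 0) unit_ball"
      by (rule mv_holomorphic_on_compose[OF mv_holomorphic_hinf_apply \<phi>])
    show "bounded ((\<lambda>z. if z \<in> unit_ball then hinf_apply g (\<phi> z) else 0) ` unit_ball)"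
      by (rule bounded_subset[OF bounded_hinf_apply[of g]]) (use ball in auto)
  qed auto
  have "bounded_linear C"
  proof (rule bounded_linear_intro[where K = 1])
    show "C (f + g) = C f + C g" for f g
      by (rule hinf_eqI) (simp add: C plus_hinf.rep_eq)
    show "C (r *\<^sub>R f) = r *\<^sub>R C f" for r f
      by (rule hinf_eqI) (simp add: C scaleR_hinf.rep_eq)
    show "norm (C f) \<le> norm f * 1" for f
      by (rule norm_hinf_leI) (use ball in \<open>auto simp: C intro!: norm_hinf_apply_le\<close>)
  qed
  then have "blinfun_apply (comp_operator \<phi>) = C"
    unfolding comp_operator_def C_def[symmetric] by (rule bounded_linear_Blinfun_apply)
  with z show ?thesis by (simp add: C)
qed

end

theory Submission
  imports Defs "HOL-Complex_Analysis.Conformal_Mappings"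
    "HOL-Computational_Algebra.Fundamental_Theorem_Algebra"
begin

text \<open>Conjugating by the involution of the ball that exchanges \<open>0\<close> and \<open>a\<close> and applying the
  one-variable Schwarz lemma on complex lines through \<open>0\<close>, one may take \<open>\<phi>\<close> to be a linear
  isometry \<open>A\<close>. If all eigenvalues of \<open>A\<close> are roots of unity, \<open>A\<close> has finite order, so
  the powers of \<open>C\<^sub>\<phi>\<close> are periodic and their means converge in norm. If \<open>A v = \<lambda> v\<close> with
  \<open>|v| = 1\<close> and \<open>\<lambda>\<close> not a root of unity, then \<open>\<langle>\<cdot>, v\<rangle>\<close> intertwines \<open>A\<close> with the rotation by \<open>\<lambda>\<close>
  of the disc. There one finds a bounded holomorphic \<open>g\<close> with \<open>g(0) = 1/2\<close> and \<open>g(r \<lambda>\<^sup>m) \<rightarrow> 0\<close> as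
  \<open>r \<rightarrow> 1\<close> for every \<open>m\<close>. A uniform limit of the means of \<open>g\<close> would be rotation invariant, hence
  constant \<open>1/2\<close>, although each mean tends to \<open>0\<close> along the radius \<open>[0, 1)\<close>.\<close>

section \<open>Rotations of the disc\<close>

lemma convergent_cesaro_of_periodic:
  fixes x :: "nat \<Rightarrow> 'a::real_normed_vector"
  assumes N: "N \<ge> 1" and per: "\<And>i. x (i + N) = x i"
  shows "convergent (\<lambda>j. (1 / real j) *\<^sub>R (\<Sum>i=1..j. x i))"
proof -
  define S where "S j = (\<Sum>i=1..j. x i)" for j
  define L where "L = (1 / real N) *\<^sub>R S N"
  \<comment> \<open>The sums satisfy \<open>S (j + N) = S j + S N\<close> and \<open>N\<close>
    copies of \<open>L\<close> make up \<open>S N\<close>, so the deviation \<open>d\<close> is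
    itself periodic. Hence it is bounded and \<open>d j / j\<close> tends to 0.\<close>
  define d where "d j = S j - real j *\<^sub>R L" for j
  have S: "S (j + N) = S j + S N" for j
  proof (induction j)
    case (Suc j)
    then show ?case using per[of "Suc j"] by (simp add: S_def)
  qed (simp add: S_def)
  have "real N *\<^sub>R L = S N" using N by (simp add: L_def)
  then have d_add: "d (j + N) = d j" for j
    by (simp add: d_def S[of j] scaleR_add_left)
  have d_mult: "d (k + m * N) = d k" for k m
  proof (induction m)
    case (Suc m)
    then show ?case using d_add[of "k + m * N"] by (simp add: algebra_simps)
  qed simp
  have d_bound: "norm (d j) \<le> (\<Sum>k<N. norm (d k))" for j
  proof -
    have "d j = d (j mod N)"
      using d_mult[of "j mod N" "j div N"] by simp
    also have "norm \<dots> \<le> (\<Sum>k<N. norm (d k))"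
      by (rule member_le_sum) (use N in auto)
    finally show ?thesis .
  qed
  have "(\<lambda>j. (1 / real j) *\<^sub>R d j) \<longlonglongrightarrow> 0"
  proof (rule Lim_null_comparison)
    show "\<forall>\<^sub>F j in sequentially. norm ((1 / real j) *\<^sub>R d j) \<le> (\<Sum>k<N. norm (d k)) / real j"
      by (intro always_eventually allI) (simp add: d_bound divide_right_mono)
    show "(\<lambda>j. (\<Sum>k<N. norm (d k)) / real j) \<longlonglongrightarrow> 0"
      by (rule lim_const_over_n)
  qed
  then have "(\<lambda>j. L + (1 / real j) *\<^sub>R d j) \<longlonglongrightarrow> L + 0"
    by (intro tendsto_intros)
  moreover have "\<forall>\<^sub>F j in sequentially.
      L + (1 / real j) *\<^sub>R d j = (1 / real j) *\<^sub>R (\<Sum>i=1..j. x i)"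
    using eventually_gt_at_top[of 0] by eventually_elim (simp add: d_def S_def algebra_simps)
  ultimately have "(\<lambda>j. (1 / real j) *\<^sub>R (\<Sum>i=1..j. x i)) \<longlonglongrightarrow> L + 0"
    by (rule Lim_transform_eventually)
  then show ?thesis by (rule convergentI)
qed

text \<open>\<open>g = 1 / (1 + k)\<close>, where \<open>k\<close> is a convex combination of the Herglotz kernels
  \<open>(b\<^sub>m + z) / (b\<^sub>m - z)\<close>: its real part is positive and blows up radially at each \<open>b\<^sub>m\<close>.\<close>

lemma bounded_holomorphic_small_near_boundary_sequence:
  fixes b :: "nat \<Rightarrow> complex"
  assumes b: "\<And>m. norm (b m) = 1"
  obtains g where "g holomorphic_on ball 0 1" "\<And>z. z \<in> ball 0 1 \<Longrightarrow> norm (g z) \<le> 1"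
    "g 0 = 1 / 2" "\<And>m r. \<lbrakk>0 \<le> r; r < 1\<rbrakk> \<Longrightarrow> norm (g (of_real r * b m)) \<le> 2 ^ Suc m * (1 - r)"
proof -
  \<comment> \<open>Since \<open>norm (b m) = 1\<close>, the kernel
    \<open>(b m + z) / (b m - z)\<close> equals the quotient written with \<open>cnj (b m)\<close>.
    The weights sum to 1, which yields \<open>k 0 = 1\<close> and \<open>g 0 = 1/2\<close>.\<close>
  define t where "t m z = (1/2) ^ Suc m * ((1 + z * cnj (b m)) / (1 - z * cnj (b m)))" for m z
  define k where "k z = (\<Sum>m. t m z)" for z
  have ne: "1 - z * cnj (b m) \<noteq> 0" if "norm z < 1" for z m
    using b[of m] that norm_mult[of z "cnj (b m)"] by fastforce
  have t_bound: "norm (t m z) \<le> (1/2) ^ Suc m * (2 / (1 - r))" if "norm z \<le> r" "r < 1" for m z r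
  proof -
    have n: "norm (z * cnj (b m)) \<le> r" using that b by (simp add: norm_mult)
    have 1: "norm (1 + z * cnj (b m)) \<le> 2"
      using norm_triangle_ineq[of 1 "z * cnj (b m)"] n that by simp
    have 2: "1 - r \<le> norm (1 - z * cnj (b m))"
      using norm_triangle_ineq2[of 1 "z * cnj (b m)"] n by simp
    have "norm ((1 + z * cnj (b m)) / (1 - z * cnj (b m))) \<le> 2 / (1 - r)"
      unfolding norm_divide using 1 2 that by (intro frac_le) auto
    moreover have "norm ((1/2) ^ Suc m :: complex) = (1/2) ^ Suc m"
      unfolding norm_power by simp
    ultimately show ?thesis
      unfolding t_def norm_mult by (simp only: mult_left_mono zero_le_power zero_le_divide_1_iff zero_le_numeral)
  qed
  have sum_bound: "summable (\<lambda>m. (1/2) ^ Suc m * (2 / (1 - r)))" for r :: real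
    by (intro summable_mult2) (simp add: summable_geometric)
  have summable_t: "summable (\<lambda>m. t m z)" if "norm z < 1" for z
    by (rule summable_comparison_test'[OF sum_bound[of "norm z"]]) (use t_bound[OF order_refl that] in auto)
  have k_hol: "k holomorphic_on ball 0 1"
  proof (rule holomorphic_uniform_sequence[where f = "\<lambda>n z. \<Sum>m<n. t m z"])
    show "(\<lambda>z. \<Sum>m<n. t m z) holomorphic_on ball 0 1" for n
      unfolding t_def by (intro holomorphic_intros) (use ne in auto)
    fix z :: complex assume z: "z \<in> ball 0 1"
    \<comment> \<open>Half the distance to the unit circle, so that one geometric majorant serves
      the whole closed disc.\<close>
    define d where "d = (1 - norm z) / 2"
    have d: "d > 0" "norm z + d < 1" using z by (auto simp: d_def field_simps)
    have n: "norm w \<le> norm z + d" if "w \<in> cball z d" for w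
      using that norm_triangle_sub[of w z] by (simp add: dist_norm norm_minus_commute)
    have "uniform_limit (cball z d) (\<lambda>n w. \<Sum>m<n. t m w) k sequentially"
      unfolding k_def
      by (rule Weierstrass_m_test[OF t_bound[OF n d(2)] sum_bound])
    moreover have "cball z d \<subseteq> ball 0 1"
      using n d by force
    ultimately show "\<exists>d>0. cball z d \<subseteq> ball 0 1 \<and>
        uniform_limit (cball z d) (\<lambda>n w. \<Sum>m<n. t m w) k sequentially"
      using d by blast
  qed simp
  have Re_t: "Re (t m z) \<ge> 0" if "norm z < 1" for m z
  proof -
    define w where "w = z * cnj (b m)"
    have w: "norm w < 1" using that b by (simp add: w_def norm_mult)
    \<comment> \<open>The real part of the Herglotz kernel is the Poisson kernel.\<close>
    have "Re ((1 + w) / (1 - w)) = (1 - (norm w)\<^sup>2) / (norm (1 - w))\<^sup>2"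
      unfolding Re_divide cmod_power2 by (simp add: power2_eq_square algebra_simps)
    also have "\<dots> \<ge> 0"
      using w by (simp add: power_le_one)
    finally have "Re ((1 + w) / (1 - w)) \<ge> 0" .
    moreover have "t m z = of_real ((1/2) ^ Suc m) * ((1 + w) / (1 - w))"
      by (simp add: t_def w_def)
    ultimately show ?thesis by (simp only: Re_complex_of_real Im_complex_of_real times_complex.sel) simp
  qed
  \<comment> \<open>All summands have nonnegative real part, so any single one bounds the sum from
    below.\<close>
  have Re_k: "Re (t m z) \<le> Re (k z)" if "norm z < 1" for m z
  proof -
    have "(\<lambda>m. Re (t m z)) sums Re (k z)"
      unfolding k_def by (intro sums_Re summable_sums summable_t that)
    then show ?thesis
      using sum_le_suminf[of "\<lambda>m. Re (t m z)" "{m}"] Re_t[OF that] by (auto simp: sums_iff)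
  qed
  have Re_k0: "Re (k z) \<ge> 0" if "norm z < 1" for z
    using Re_k[OF that, of 0] Re_t[OF that, of 0] by linarith
  have norm_k: "1 + Re (k z) \<le> norm (1 + k z)" for z
    using complex_Re_le_cmod[of "1 + k z"] by simp
  have k0: "k 0 = 1"
    unfolding k_def t_def using power_half_series sums_of_real[OF power_half_series, where 'a = complex]
    by (simp add: sums_iff)
  define g where "g z = 1 / (1 + k z)" for z
  show ?thesis
  proof (rule that)
    show "g holomorphic_on ball 0 1"
      unfolding g_def
    proof (intro holomorphic_intros k_hol)
      fix z :: complex assume "z \<in> ball 0 1"
      then show "1 + k z \<noteq> 0" using norm_k[of z] Re_k0[of z] by auto
    qed
    show "norm (g z) \<le> 1" if "z \<in> ball 0 1" for z
      using norm_k[of z] Re_k0[of z] that by (simp add: g_def norm_divide divide_le_eq)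
    show "g 0 = 1 / 2" by (simp add: g_def k0)
    fix m and r :: real assume r: "0 \<le> r" "r < 1"
    have z: "norm (of_real r * b m) < 1" using r b by (simp add: norm_mult)
    have bb: "b m * cnj (b m) = 1" using b[of m] by (simp add: complex_norm_square[symmetric])
    have "t m (of_real r * b m) = of_real ((1/2) ^ Suc m * ((1 + r) / (1 - r)))"
      by (simp add: t_def mult.assoc bb)
    then have "(1/2) ^ Suc m * ((1 + r) / (1 - r)) \<le> Re (k (of_real r * b m))"
      using Re_k[OF z, of m] by (metis Re_complex_of_real)
    moreover have "(1/2) ^ Suc m * (1 / (1 - r)) \<le> (1/2) ^ Suc m * ((1 + r) / (1 - r))"
      using r by (intro mult_left_mono divide_right_mono) auto
    ultimately have "(1/2) ^ Suc m * (1 / (1 - r)) \<le> norm (1 + k (of_real r * b m))"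
      using norm_k[of "of_real r * b m"] by linarith
    moreover have "0 < (1/2) ^ Suc m * (1 / (1 - r))" using r by simp
    ultimately have "1 / norm (1 + k (of_real r * b m)) \<le> 1 / ((1/2) ^ Suc m * (1 / (1 - r)))"
      by (intro frac_le) auto
    then show "norm (g (of_real r * b m)) \<le> 2 ^ Suc m * (1 - r)"
      by (simp add: g_def norm_divide power_divide)
  qed
qed

lemma irrational_rotation_not_mean_ergodic:
  fixes l :: complex
  assumes l: "norm l = 1" and irr: "\<forall>m::nat. m \<ge> 1 \<longrightarrow> l ^ m \<noteq> 1"
  shows "\<exists>g. g holomorphic_on ball 0 1 \<and> (\<forall>z\<in>ball 0 1. norm (g z) \<le> 1) \<and>
    (\<forall>p. p holomorphic_on ball 0 1 \<longrightarrow>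
      \<not> uniform_limit (ball 0 1) (\<lambda>j z. (1 / of_nat j) * (\<Sum>i=1..j. g (l ^ i * z))) p sequentially)"
proof -
  obtain g where g: "g holomorphic_on ball 0 1" "\<And>z. z \<in> ball 0 1 \<Longrightarrow> norm (g z) \<le> 1"
    "g 0 = 1 / 2" "\<And>m r. \<lbrakk>0 \<le> r; r < 1\<rbrakk> \<Longrightarrow> norm (g (of_real r * l ^ m)) \<le> 2 ^ Suc m * (1 - r)"
    using bounded_holomorphic_small_near_boundary_sequence[of "\<lambda>m. l ^ m"] l
    by (auto simp: norm_power)
  define M where "M j z = (1 / of_nat j) * (\<Sum>i=1..j. g (l ^ i * z))" for j z
  have False if p: "p holomorphic_on ball 0 1" and lim: "uniform_limit (ball 0 1) M p sequentially"
    for p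
  proof -
    have lim_p: "(\<lambda>j. M j z) \<longlonglongrightarrow> p z" if "z \<in> ball 0 1" for z
      using tendsto_uniform_limitI[OF lim that] .
    have rot: "l ^ i * z \<in> ball 0 1" if "z \<in> ball 0 1" for i z
      using that l by (simp add: norm_mult norm_power)
    have inv: "p (l * z) = p z" if z: "z \<in> ball 0 1" for z
    proof -
      have lz: "l * z \<in> ball 0 1" using rot[OF z, of 1] by simp
      \<comment> \<open>Rotating \<open>z\<close> shifts the summation index by one; the difference
        telescopes to two bounded end terms.\<close>
      have diff: "M j (l * z) - M j z = (g (l ^ Suc j * z) - g (l * z)) / of_nat j" for j
      proof -
        have "(\<Sum>i=1..j. g (l ^ i * (l * z))) - (\<Sum>i=1..j. g (l ^ i * z))
            = (\<Sum>i=1..j. g (l ^ Suc i * z) - g (l ^ i * z))"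
          by (simp add: sum_subtractf mult_ac)
        also have "\<dots> = g (l ^ Suc j * z) - g (l * z)"
          using sum_Suc_diff[of 1 j "\<lambda>i. g (l ^ i * z)"] by simp
        finally show ?thesis
          unfolding M_def right_diff_distrib[symmetric] by simp
      qed
      have "(\<lambda>j. M j (l * z) - M j z) \<longlonglongrightarrow> 0"
      proof (rule Lim_null_comparison)
        show "\<forall>\<^sub>F j in sequentially. norm (M j (l * z) - M j z) \<le> 2 / real j"
        proof (intro always_eventually allI)
          fix j
          have "norm (g (l ^ Suc j * z) - g (l * z)) \<le> 2"
            using g(2)[OF rot[OF z, of "Suc j"]] g(2)[OF lz] by norm
          then show "norm (M j (l * z) - M j z) \<le> 2 / real j"
            unfolding diff norm_divide by (simp add: divide_right_mono)
        qed
        show "(\<lambda>j. 2 / real j) \<longlonglongrightarrow> 0" by (rule lim_const_over_n)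
      qed
      moreover have "(\<lambda>j. M j (l * z) - M j z) \<longlonglongrightarrow> p (l * z) - p z"
        by (intro tendsto_diff lim_p z lz)
      ultimately show ?thesis
        using LIMSEQ_unique by fastforce
    qed
    \<comment> \<open>Invariance gives \<open>(l ^ n - 1) * (deriv ^^ n) p 0 = 0\<close>, and the
      first factor is nonzero for \<open>n > 0\<close>.\<close>
    have "(deriv ^^ n) p 0 = 0" if "n > 0" for n
    proof -
      have "(deriv ^^ n) (\<lambda>z. p (l * z)) 0 = l ^ n * (deriv ^^ n) p (l * 0)"
        by (rule higher_deriv_compose_linear[OF p, where S = "ball 0 1"]) (use rot[of _ 1] in \<open>auto simp: l norm_mult\<close>)
      moreover have "(deriv ^^ n) (\<lambda>z. p (l * z)) 0 = (deriv ^^ n) p 0"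
        by (rule higher_deriv_transform_within_open[where S = "ball 0 1"])
          (use p inv in \<open>auto intro!: holomorphic_intros holomorphic_on_compose_gen[OF _ p, unfolded o_def] simp: norm_mult l\<close>)
      ultimately show ?thesis using irr that by auto
    qed
    then have const: "p z = p 0" if "z \<in> ball 0 1" for z
      using holomorphic_fun_eq_const_on_connected[OF p _ _ _ _ that, of 0] by auto
    \<comment> \<open>The junk value \<open>M 0 0 = 0\<close> has to be avoided here and in the
      choice of \<open>j\<close> below.\<close>
    have M0: "M j 0 = 1 / 2" if "j \<ge> 1" for j
      using that by (simp add: M_def g(3))
    have p0: "p 0 = 1 / 2"
    proof (rule LIMSEQ_unique[OF lim_p])
      have "\<forall>\<^sub>F j in sequentially. M j 0 = 1 / 2"
        using eventually_ge_at_top[of 1] by eventually_elim (rule M0)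
      then show "(\<lambda>j. M j 0) \<longlonglongrightarrow> 1 / 2" by (rule tendsto_eventually)
    qed simp
    have "\<forall>\<^sub>F j in sequentially. \<forall>z\<in>ball 0 1. dist (M j z) (p z) < 1/4"
      by (rule uniform_limitD[OF lim]) simp
    with eventually_ge_at_top[of 1]
    have "\<forall>\<^sub>F j in sequentially. j \<ge> 1 \<and> (\<forall>z\<in>ball 0 1. dist (M j z) (p z) < 1/4)"
      by eventually_elim auto
    then obtain j where j: "j \<ge> 1" "\<And>z. z \<in> ball 0 1 \<Longrightarrow> dist (M j z) (p z) < 1/4"
      by (auto simp: eventually_sequentially)
    \<comment> \<open>Now \<open>j\<close> is fixed and \<open>r\<close> may depend on it:
      \<open>2 ^ Suc j * (1 - r) = 1/4\<close>, so every term of the mean has norm at most 1/4, too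
      small for a mean within less than 1/4 of 1/2.\<close>
    define r :: real where "r = 1 - 1 / 2 ^ (j + 3)"
    have r: "0 \<le> r" "r < 1" by (auto simp: r_def)
    have "norm (\<Sum>i=1..j. g (l ^ i * of_real r)) \<le> (\<Sum>i=1..j. 2 ^ Suc j * (1 - r))"
    proof (rule sum_norm_le)
      fix i assume "i \<in> {1..j}"
      have "norm (g (l ^ i * of_real r)) \<le> 2 ^ Suc i * (1 - r)"
        using g(4)[OF r, of i] by (simp add: mult.commute)
      also have "\<dots> \<le> 2 ^ Suc j * (1 - r)"
        using r \<open>i \<in> {1..j}\<close> by (intro mult_right_mono power_increasing) auto
      finally show "norm (g (l ^ i * of_real r)) \<le> 2 ^ Suc j * (1 - r)" .
    qed
    also have "\<dots> = real j / 4" by (simp add: r_def power_add)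
    finally have "norm (M j (of_real r)) \<le> 1/4"
      using j(1) by (simp add: M_def norm_mult norm_divide field_simps)
    moreover have "dist (M j (of_real r)) (1/2) < 1/4"
      using j(2)[of "of_real r"] const[of "of_real r"] r p0 by simp
    moreover have "norm (1/2 :: complex) \<le> norm (M j (of_real r)) + dist (M j (of_real r)) (1/2)"
      using norm_triangle_sub[of "1/2" "M j (of_real r)"] by (simp add: dist_norm norm_minus_commute)
    ultimately show False by simp
  qed
  with g(1,2) show ?thesis unfolding M_def by (intro exI[of _ g]) blast
qed

section \<open>Linear isometries\<close>

definition cinner :: "complex^'n \<Rightarrow> complex^'n \<Rightarrow> complex"
  where "cinner z w = (\<Sum>i\<in>UNIV. z $ i * cnj (w $ i))"

lemma cinner_add_left: "cinner (x + y) w = cinner x w + cinner y w"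
  by (simp add: cinner_def algebra_simps sum.distrib)

lemma cinner_diff_left: "cinner (x - y) w = cinner x w - cinner y w"
  by (simp add: cinner_def algebra_simps sum_subtractf)

lemma cinner_scale_left: "cinner (c *s x) w = c * cinner x w"
  by (simp add: cinner_def algebra_simps sum_distrib_left)

lemma cinner_scale_right: "cinner x (c *s w) = cnj c * cinner x w"
  by (simp add: cinner_def algebra_simps sum_distrib_left)

lemma cinner_diff_right: "cinner x (y - w) = cinner x y - cinner x w"
  by (simp add: cinner_def algebra_simps sum_subtractf)

lemma cinner_commute: "cinner x y = cnj (cinner y x)"
  by (simp add: cinner_def mult.commute)

lemma Re_cinner: "Re (cinner x y) = x \<bullet> y"
  by (simp add: cinner_def inner_vec_def inner_complex_def)

lemma cinner_self: "cinner x x = of_real ((norm x)\<^sup>2)"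
proof (rule complex_eqI)
  show "Re (cinner x x) = Re (of_real ((norm x)\<^sup>2))"
    by (simp add: Re_cinner dot_square_norm)
  show "Im (cinner x x) = Im (of_real ((norm x)\<^sup>2))"
    by (simp add: cinner_def mult.commute)
qed

lemma norm_cvec_scale: "norm (c *s x) = norm c * norm x" for x :: "complex^'n"
proof -
  have "complex_of_real ((norm (c *s x))\<^sup>2) = (c * cnj c) * cinner x x"
    by (simp only: cinner_self[symmetric] cinner_scale_left cinner_scale_right mult_ac)
  also have "\<dots> = of_real ((norm c * norm x)\<^sup>2)"
    by (simp only: complex_norm_square[symmetric] cinner_self power_mult_distrib of_real_mult)
  finally have "complex_of_real ((norm (c *s x))\<^sup>2) = of_real ((norm c * norm x)\<^sup>2)" .
  then show ?thesis
    unfolding of_real_eq_iff by (simp add: power2_eq_iff_nonneg)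
qed

text \<open>A unimodular factor \<open>c\<close> turns \<open>cinner x y\<close> into its modulus,
  which reduces the claim to the real Cauchy-Schwarz inequality for \<open>c *s x\<close> and
  \<open>y\<close>.\<close>

lemma norm_cinner_le: "norm (cinner x y) \<le> norm x * norm y"
proof (cases "cinner x y = 0")
  case False
  define c where "c = cnj (sgn (cinner x y))"
  have c: "norm c = 1" using False by (simp add: c_def norm_sgn)
  have "c * cinner x y = of_real (norm (cinner x y))"
    using False unfolding c_def sgn_eq
    by (simp add: complex_norm_square[symmetric] mult.commute power2_eq_square divide_simps)
  then have "norm (cinner x y) = (c *s x) \<bullet> y"
    by (metis Re_cinner Re_complex_of_real cinner_scale_left)
  also have "\<dots> \<le> norm (c *s x) * norm y" by (rule norm_cauchy_schwarz)
  finally show ?thesis by (simp add: norm_cvec_scale c)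
qed simp

text \<open>Equality case of Cauchy-Schwarz: expanding the square of
  \<open>norm (x - c *s v)\<close> leaves \<open>(norm x)\<^sup>2 - (norm c)\<^sup>2\<close>, which
  is at most 0.\<close>

lemma eq_scale_of_cinner_eq:
  assumes "norm v = 1" "norm x \<le> norm c" "cinner x v = c"
  shows "x = c *s v"
proof -
  have "(norm (x - c *s v))\<^sup>2 = (norm x)\<^sup>2 + (norm (c *s v))\<^sup>2 - 2 * Re (cinner x (c *s v))"
    unfolding Re_cinner by (simp add: power2_norm_eq_inner inner_diff inner_commute)
  also have "cinner x (c *s v) = of_real ((norm c)\<^sup>2)"
    unfolding cinner_scale_right assms(3) by (simp only: complex_norm_square mult.commute)
  also have "(norm x)\<^sup>2 + (norm (c *s v))\<^sup>2 - 2 * Re (of_real ((norm c)\<^sup>2)) \<le> 0"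
    using assms power_mono[OF assms(2), of 2] by (simp add: norm_cvec_scale)
  finally show ?thesis by simp
qed

text \<open>Polarisation handles the real part; the imaginary part is the real part with
  \<open>w\<close> replaced by \<open>\<i> *s w\<close>.\<close>

lemma cinner_isometry:
  fixes A :: "complex^'n^'n"
  assumes iso: "\<And>z. norm (A *v z) = norm z"
  shows "cinner (A *v z) (A *v w) = cinner z w"
proof -
  have Re: "Re (cinner (A *v z) (A *v w)) = Re (cinner z w)" for z w
    unfolding Re_cinner dot_norm matrix_vector_right_distrib[symmetric] iso ..
  have Im: "Im (cinner z w) = Re (cinner z (\<i> *s w))" for z w :: "complex^'n"
    by (simp add: cinner_scale_right)
  show ?thesis
  proof (rule complex_eqI)
    show "Im (cinner (A *v z) (A *v w)) = Im (cinner z w)"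
      unfolding Im vector_scalar_commute[symmetric] by (rule Re)
  qed (rule Re)
qed

section \<open>Polynomials in a matrix, evaluated on a vector by Horner's scheme\<close>

definition poly_apply :: "'a::field^'n^'n \<Rightarrow> 'a poly \<Rightarrow> 'a^'n \<Rightarrow> 'a^'n"
  where "poly_apply A p w = fold_coeffs (\<lambda>c v. c *s w + A *v v) p 0"

lemma poly_apply_0 [simp]: "poly_apply A 0 w = 0"
  by (simp add: poly_apply_def)

lemma poly_apply_pCons [simp]: "poly_apply A (pCons c p) w = c *s w + A *v poly_apply A p w"
  by (cases "p = 0 \<and> c = 0") (auto simp: poly_apply_def)

lemma poly_apply_add: "poly_apply A (p + q) w = poly_apply A p w + poly_apply A q w"
  by (induction p q rule: poly_induct2) (simp_all add: algebra_simps matrix_vector_right_distrib)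

lemma poly_apply_smult: "poly_apply A (smult c p) w = c *s poly_apply A p w"
  by (induction p) (simp_all add: vector_scalar_commute vector_add_ldistrib vector_smult_assoc)

lemma poly_apply_diff: "poly_apply A (p - q) w = poly_apply A p w - poly_apply A q w"
  using poly_apply_add[of A "p - q" q w] by simp

lemma poly_apply_sum: "poly_apply A (sum f I) w = (\<Sum>i\<in>I. poly_apply A (f i) w)"
  by (induction I rule: infinite_finite_induct) (simp_all add: poly_apply_add)

lemma poly_apply_monom: "poly_apply A (monom c i) w = c *s ((*v) A ^^ i) w"
  by (induction i) (simp_all add: monom_0 monom_Suc vector_scalar_commute)

lemma poly_apply_diff_right: "poly_apply A p (v - w) = poly_apply A p v - poly_apply A p w"
  by (induction p) (simp_all add: add_diff_add matrix_vector_mult_diff_distrib)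

lemma poly_apply_scale_right: "poly_apply A p (c *s w) = c *s poly_apply A p w"
  by (induction p)
    (simp_all add: vector_scalar_commute vector_add_ldistrib vector_smult_assoc mult.commute)

lemma poly_apply_mult_right: "poly_apply A p (A *v w) = A *v poly_apply A p w"
  by (induction p) (simp_all add: matrix_vector_right_distrib vector_scalar_commute)

lemma poly_apply_linear_factor:
  "poly_apply A ([:-c, 1:] * q) w = A *v poly_apply A q w - c *s poly_apply A q w"
  by (simp add: poly_apply_diff poly_apply_smult)

text \<open>The vectors \<open>w, A w, ..., A^n w\<close> are \<open>n + 1\<close> vectors in
  dimension \<open>n\<close>, and a linear relation among them is a polynomial.\<close>

lemma annihilating_poly_exists:
  fixes A :: "'a::field^'n^'n"
  obtains p where "p \<noteq> 0" "poly_apply A p w = 0"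
proof (cases "inj_on (\<lambda>i. ((*v) A ^^ i) w) {..CARD('n)}")
  \<comment> \<open>Linear dependence is a notion for sets and does not see repetitions, so
    coinciding iterates are treated separately, by a difference of two monomials.\<close>
  case False
  then obtain i j where ij: "((*v) A ^^ i) w = ((*v) A ^^ j) w" "i \<noteq> j"
    by (auto simp: inj_on_def)
  have "coeff (monom 1 i - monom 1 j :: 'a poly) i \<noteq> 0"
    using ij(2) by simp
  then have "(monom 1 i - monom 1 j :: 'a poly) \<noteq> 0" by (metis coeff_0)
  then show ?thesis
    using that[of "monom 1 i - monom 1 j"] ij(1) by (simp add: poly_apply_diff poly_apply_monom)
next
  case True
  define x where "x i = ((*v) A ^^ i) w" for i
  have inj: "inj_on x {..CARD('n)}" using True by (simp add: x_def[abs_def])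
  have "card (x ` {..CARD('n)}) = Suc CARD('n)"
    by (simp add: card_image[OF inj])
  then have "vec.dependent (x ` {..CARD('n)})"
    using vec.independent_bound_general[of "x ` {..CARD('n)}"]
      dim_subset_UNIV_cart_gen[of "x ` {..CARD('n)}"] by auto
  then obtain t u where t: "finite t" "t \<subseteq> x ` {..CARD('n)}" "(\<Sum>v\<in>t. u v *s v) = 0"
    "\<exists>v\<in>t. u v \<noteq> 0"
    unfolding vec.dependent_explicit by blast
  obtain I where I: "I \<subseteq> {..CARD('n)}" "t = x ` I"
    using t(2) by (auto simp: subset_image_iff)
  then have fin: "finite I" and injI: "inj_on x I"
    using finite_subset inj_on_subset[OF inj] by auto
  define p where "p = (\<Sum>i\<in>I. monom (u (x i)) i)"
  have "poly_apply A p w = (\<Sum>i\<in>I. u (x i) *s x i)"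
    by (simp add: p_def poly_apply_sum poly_apply_monom x_def)
  also have "\<dots> = 0"
    using t(3) unfolding I(2) by (simp add: sum.reindex[OF injI])
  finally have "poly_apply A p w = 0" .
  moreover obtain i where "i \<in> I" "u (x i) \<noteq> 0" using t(4) I(2) by auto
  then have "coeff p i \<noteq> 0" using fin by (simp add: p_def coeff_sum)
  then have "p \<noteq> 0" by auto
  ultimately show ?thesis using that by blast
qed

section \<open>Isometries whose eigenvalues are roots of unity have finite order\<close>

lemma eigenvalues_isometry:
  fixes A :: "complex^'n^'n"
  assumes "\<And>z. norm (A *v z) = norm z" "\<mu> \<in> eigenvalues A"
  shows "norm \<mu> = 1"
proof -
  obtain v where v: "v \<noteq> 0" "A *v v = \<mu> *s v" using assms(2) by (auto simp: eigenvalues_def)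
  have "norm \<mu> * norm v = 1 * norm v" using assms(1)[of v] v(2) by (simp add: norm_cvec_scale)
  then show ?thesis using v(1) by simp
qed

lemma funpow_matrix_isometry:
  fixes A :: "complex^'n^'n"
  assumes "\<And>z. norm (A *v z) = norm z"
  shows "cinner (((*v) A ^^ i) z) (((*v) A ^^ i) w) = cinner z w"
  using cinner_isometry[OF assms] by (induction i) simp_all

lemma funpow_matrix_diff: "((*v) A ^^ i) (z - w) = ((*v) A ^^ i) z - ((*v) A ^^ i) w"
  for A :: "'a::comm_ring_1^'n^'n"
  by (induction i) (simp_all add: matrix_vector_mult_diff_distrib)

lemma funpow_matrix_scale: "((*v) A ^^ i) (c *s w) = c *s ((*v) A ^^ i) w"
  for A :: "'a::field^'n^'n"
  by (induction i) (simp_all add: vector_scalar_commute)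

lemma funpow_matrix_eigenvector: "A *v v = c *s v \<Longrightarrow> ((*v) A ^^ i) v = c ^ i *s v"
  for A :: "'a::field^'n^'n"
  by (induction i) (simp_all add: vector_scalar_commute vector_smult_assoc mult.commute)

lemma funpow_mult_fixed: "(f ^^ M) x = x \<Longrightarrow> (f ^^ (M * K)) x = x"
  by (induction K) (simp_all add: funpow_add)

text \<open>Induction on the degree of an annihilating polynomial. Splitting off the factor \<open>X - \<mu>\<close>, some
  power \<open>C\<close> of \<open>A\<close> fixes \<open>(A - \<mu>) w\<close>, so \<open>x = C w - w\<close> is a \<open>\<mu>\<close>-eigenvector and may be assumed to be
  fixed by \<open>C\<close>; then \<open>\<langle>x, x\<rangle> = \<langle>C w, C x\<rangle> - \<langle>w, x\<rangle> = 0\<close>.\<close>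

lemma isometry_vector_periodic:
  fixes A :: "complex^'n^'n"
  assumes iso: "\<And>z. norm (A *v z) = norm z"
    and roots: "\<And>\<mu>. \<mu> \<in> eigenvalues A \<Longrightarrow> \<exists>m::nat. m \<ge> 1 \<and> \<mu> ^ m = 1"
    and "p \<noteq> 0" "poly_apply A p w = 0"
  shows "\<exists>N\<ge>1. ((*v) A ^^ N) w = w"
  using assms(3,4)
proof (induction "degree p" arbitrary: p w)
  case 0
  then obtain c where "p = [:c:]" by (metis degree_eq_zeroE)
  with 0 have "w = 0" by (simp add: vector_mul_eq_0)
  then show ?case by (intro exI[of _ 1]) simp
next
  case (Suc n)
  obtain \<mu> where "poly p \<mu> = 0"
    using fundamental_theorem_of_algebra[of p] Suc(2) by (auto simp: constant_degree)
  then obtain q where q: "p = [:-\<mu>, 1:] * q" by (auto simp: poly_eq_0_iff_dvd)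
  then have "q \<noteq> 0" using Suc.prems by auto
  then have "n = degree q"
    using Suc(2) unfolding q by (subst (asm) degree_mult_eq) auto
  note IH = Suc(1)[OF this \<open>q \<noteq> 0\<close>]
  have eq: "A *v poly_apply A q w = \<mu> *s poly_apply A q w"
    using Suc.prems unfolding q poly_apply_linear_factor by simp
  show ?case
  proof (cases "poly_apply A q w = 0")
    case True
    then show ?thesis by (rule IH)
  next
    case False
    then have "\<mu> \<in> eigenvalues A" using eq by (auto simp: eigenvalues_def)
    then obtain K where K: "K \<ge> 1" "\<mu> ^ K = 1" using roots by blast
    define u where "u = A *v w - \<mu> *s w"
    have "poly_apply A q u = 0"
      by (simp add: u_def poly_apply_diff_right poly_apply_mult_right poly_apply_scale_right eq)
    then obtain M where M: "M \<ge> 1" "((*v) A ^^ M) u = u" using IH by blast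
    \<comment> \<open>The factor \<open>M\<close> makes \<open>C\<close> fix \<open>u\<close>; the
      factor \<open>K\<close> makes \<open>C\<close> act as the identity on
      \<open>\<mu>\<close>-eigenvectors.\<close>
    define C where "C = (*v) A ^^ (M * K)"
    have Cu: "C u = u" unfolding C_def by (rule funpow_mult_fixed[OF M(2)])
    define x where "x = C w - w"
    \<comment> \<open>\<open>C\<close> is a power of \<open>A\<close> and commutes with it.\<close>
    have "A *v x - \<mu> *s x = C u - u"
      unfolding x_def u_def C_def
      by (simp add: funpow_matrix_diff funpow_matrix_scale matrix_vector_mult_diff_distrib
          vector_ssub_ldistrib funpow_swap1)
    then have "A *v x = \<mu> *s x" using Cu by simp
    then have "C x = \<mu> ^ (M * K) *s x"
      unfolding C_def by (rule funpow_matrix_eigenvector)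
    also have "\<mu> ^ (M * K) = 1" using K(2) by (simp add: mult.commute[of M] power_mult)
    finally have "C x = x" by simp
    then have "cinner x x = cinner (C w) (C x) - cinner w x"
      by (simp add: x_def cinner_diff_left)
    also have "\<dots> = 0" unfolding C_def by (simp add: funpow_matrix_isometry[OF iso])
    finally have "x = 0" by (simp add: cinner_self)
    then show ?thesis
      using M(1) K(1) by (intro exI[of _ "M * K"]) (auto simp: x_def C_def)
  qed
qed

text \<open>Each basis vector has its own period. The product of these periods works for all of
  them, and by linearity for every vector.\<close>

lemma isometry_periodic:
  fixes A :: "complex^'n^'n"
  assumes iso: "\<And>z. norm (A *v z) = norm z"
    and roots: "\<And>\<mu>. \<mu> \<in> eigenvalues A \<Longrightarrow> \<exists>m::nat. m \<ge> 1 \<and> \<mu> ^ m = 1"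
  obtains N where "N \<ge> 1" "\<And>z. ((*v) A ^^ N) z = z"
proof -
  have "\<exists>N\<ge>1. ((*v) A ^^ N) (axis i 1) = axis i 1" for i
    using annihilating_poly_exists[of A "axis i 1"] isometry_vector_periodic[OF iso roots] by metis
  then obtain N where N: "\<And>i. N i \<ge> 1" "\<And>i. ((*v) A ^^ N i) (axis i 1) = axis i 1"
    by metis
  define K where "K = (\<Prod>i\<in>UNIV. N i)"
  have fix_axis: "((*v) A ^^ K) (axis i 1) = axis i 1" for i
    unfolding K_def using prod.remove[of UNIV i N] funpow_mult_fixed[OF N(2)] by simp
  have sum: "((*v) A ^^ k) (\<Sum>i\<in>I. f i) = (\<Sum>i\<in>I. ((*v) A ^^ k) (f i))" for k f and I :: "'n set"
    by (induction k) (simp_all add: vec.linear_sum[OF matrix_vector_mul_linear_gen])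
  have "((*v) A ^^ K) z = z" for z
  proof -
    have z: "z = (\<Sum>i\<in>UNIV. z $ i *s axis i 1)" by (simp add: basis_expansion)
    show ?thesis
      by (subst (1 2) z) (simp only: sum funpow_matrix_scale fix_axis)
  qed
  moreover have "K \<ge> 1" using N(1) unfolding K_def by (simp add: Suc_le_eq prod_pos)
  ultimately show ?thesis using that by blast
qed

section \<open>Automorphisms of the ball\<close>

lemma scaleR_eq_cvec_scale: "r *\<^sub>R x = complex_of_real r *s x"
  unfolding vec_eq_iff vector_scaleR_component by (simp add: scaleR_conv_of_real)

lemma mv_holomorphic_on_affine:
  fixes L :: "complex^'n \<Rightarrow> complex"
  assumes "\<And>x y. L (x + y) = L x + L y" "\<And>c x. L (c *s x) = c * L x"
  shows "mv_holomorphic_on (\<lambda>z. k + L z) S"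
proof -
  have "linear L"
    by (rule linearI) (simp_all add: assms scaleR_eq_cvec_scale scaleR_conv_of_real)
  then have "((\<lambda>z. k + L z) has_derivative L) (at z)" for z
    by (auto intro!: derivative_eq_intros linear_imp_has_derivative)
  then show ?thesis
    using assms(2) unfolding mv_holomorphic_on_def by blast
qed

lemma mv_holomorphic_on_divide:
  assumes "mv_holomorphic_on f S" "mv_holomorphic_on g S" and nz: "\<And>z. z \<in> S \<Longrightarrow> g z \<noteq> 0"
  shows "mv_holomorphic_on (\<lambda>z. f z / g z) S"
  unfolding mv_holomorphic_on_def
proof
  fix z assume z: "z \<in> S"
  with assms obtain D E
    where D: "(f has_derivative D) (at z)" "\<forall>c h. D (c *s h) = c * D h"
      and E: "(g has_derivative E) (at z)" "\<forall>c h. E (c *s h) = c * E h"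
    unfolding mv_holomorphic_on_def by metis
  have "((\<lambda>z. f z / g z) has_derivative
      (\<lambda>h. - f z * (inverse (g z) * E h * inverse (g z)) + D h / g z)) (at z)"
    by (rule has_derivative_divide[OF D(1) E(1) nz[OF z]])
  then show "\<exists>D. ((\<lambda>z. f z / g z) has_derivative D) (at z) \<and> (\<forall>c h. D (c *s h) = c * D h)"
    using D(2) E(2) by (intro exI conjI) (assumption, simp add: algebra_simps)
qed

lemma holomorphic_map_onI:
  assumes "\<And>z. z \<in> S \<Longrightarrow> \<exists>D. (F has_derivative D) (at z) \<and> (\<forall>c h. D (c *s h) = c *s D h)"
  shows "holomorphic_map_on F S"
  unfolding holomorphic_map_on_def mv_holomorphic_on_def
proof (intro allI ballI)
  fix i z assume "z \<in> S"
  then obtain D where "(F has_derivative D) (at z)" "\<forall>c h. D (c *s h) = c *s D h"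
    using assms by blast
  then show "\<exists>D. ((\<lambda>z. F z $ i) has_derivative D) (at z) \<and> (\<forall>c h. D (c *s h) = c * D h)"
    by (intro exI[of _ "\<lambda>h. D h $ i"])
      (auto intro: bounded_linear.has_derivative[OF bounded_linear_vec_nth])
qed

lemma holomorphic_map_on_compose:
  assumes F: "holomorphic_map_on F S" and G: "holomorphic_map_on G T" and "F ` S \<subseteq> T"
  shows "holomorphic_map_on (\<lambda>z. G (F z)) S"
proof (rule holomorphic_map_onI)
  fix z assume z: "z \<in> S"
  obtain D where D: "(F has_derivative D) (at z)" "\<And>c h. D (c *s h) = c *s D h"
    using holomorphic_map_on_has_derivative[OF F z] by metis
  have "F z \<in> T" using assms(3) z by blast
  then obtain E where E: "(G has_derivative E) (at (F z))" "\<And>c h. E (c *s h) = c *s E h"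
    using holomorphic_map_on_has_derivative[OF G] by metis
  show "\<exists>D. ((\<lambda>z. G (F z)) has_derivative D) (at z) \<and> (\<forall>c h. D (c *s h) = c *s D h)"
    using has_derivative_compose[OF D(1) E(1)] D(2) E(2) by auto
qed

lemma ball_self_map_compose:
  assumes "ball_self_map F" "ball_self_map G"
  shows "ball_self_map (\<lambda>z. G (F z))"
  using assms holomorphic_map_on_compose[of F unit_ball G unit_ball]
  unfolding ball_self_map_def by auto

lemma ball_self_map_has_derivative:
  assumes "ball_self_map F" "z \<in> unit_ball"
  shows "(F has_derivative (\<lambda>h. jacobian F (at z) *v h)) (at z)"
  using assms has_derivative_jacobian unfolding ball_self_map_def by blast

text \<open>By the chain rule both sides are derivatives of the same map at \<open>z\<close>, and
  derivatives are unique. The general commuting square covers inverses (two sides the identity) as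
  well as conjugation.\<close>

lemma jacobian_intertwine:
  assumes maps: "ball_self_map F" "ball_self_map G" "ball_self_map H" "ball_self_map K"
    and z: "z \<in> unit_ball" and eq: "\<And>x. x \<in> unit_ball \<Longrightarrow> F (H x) = K (G x)"
  shows "jacobian F (at (H z)) *v (jacobian H (at z) *v h)
       = jacobian K (at (G z)) *v (jacobian G (at z) *v h)"
proof -
  note D = ball_self_map_has_derivative
  have FH: "((\<lambda>x. F (H x)) has_derivative
      (\<lambda>h. jacobian F (at (H z)) *v (jacobian H (at z) *v h))) (at z)"
    using maps z ball_self_mapD by (intro has_derivative_compose[OF D D]) auto
  have KG: "((\<lambda>x. K (G x)) has_derivative
      (\<lambda>h. jacobian K (at (G z)) *v (jacobian G (at z) *v h))) (at z)"
    using maps z ball_self_mapD by (intro has_derivative_compose[OF D D]) auto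
  have "((\<lambda>x. F (H x)) has_derivative
      (\<lambda>h. jacobian K (at (G z)) *v (jacobian G (at z) *v h))) (at z)"
    by (rule has_derivative_transform_within_open[OF KG open_ball z]) (simp add: eq)
  from has_derivative_unique[OF FH this] show ?thesis by metis
qed

lemma ball_self_map_id: "ball_self_map (\<lambda>z. z)"
  unfolding ball_self_map_def by (auto intro!: holomorphic_map_onI exI[of _ "\<lambda>h. h"])

lemma jacobian_inverse:
  assumes "ball_self_map F" "ball_self_map G" "z \<in> unit_ball"
    and "\<And>x. x \<in> unit_ball \<Longrightarrow> G (F x) = x"
  shows "jacobian G (at (F z)) *v (jacobian F (at z) *v h) = h"
proof -
  have "jacobian (\<lambda>x :: complex^'a. x) (at z) *v h = h" for h
    using has_derivative_unique[OF ball_self_map_has_derivative[OF ball_self_map_id assms(3)]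
        has_derivative_ident] by metis
  then show ?thesis
    using jacobian_intertwine[of G "\<lambda>x. x" F "\<lambda>x. x" z h] ball_self_map_id assms by simp
qed

section \<open>Slices along complex lines and the Schwarz lemma\<close>

lemma has_field_derivative_slice:
  fixes f :: "complex^'n \<Rightarrow> complex"
  assumes "(f has_derivative D) (at (c *s u))" "\<And>c h. D (c *s h) = c * D h"
  shows "((\<lambda>c. f (c *s u)) has_field_derivative D u) (at c)"
proof -
  have "linear (\<lambda>c :: complex. c *s u)"
    by (rule linearI) (simp_all add: vec_eq_iff algebra_simps)
  then have "((\<lambda>c :: complex. c *s u) has_derivative (\<lambda>c. c *s u)) (at c)"
    by (rule linear_imp_has_derivative)
  from has_derivative_compose[OF this assms(1)] show ?thesis
    unfolding has_field_derivative_def assms(2) mult.commute[of _ "D u"] .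
qed

lemma mv_holomorphic_slice:
  assumes "mv_holomorphic_on f unit_ball" "norm u \<le> 1"
  shows "(\<lambda>c. f (c *s u)) holomorphic_on ball 0 1"
  unfolding holomorphic_on_open[OF open_ball]
proof
  fix c :: complex assume "c \<in> ball 0 1"
  then have "norm c * norm u < 1"
    using mult_left_mono[OF assms(2), of "norm c"] by (simp add: le_less_trans)
  then have "c *s u \<in> unit_ball" by (simp add: norm_cvec_scale)
  with assms(1) obtain D where "(f has_derivative D) (at (c *s u))" "\<And>c h. D (c *s h) = c * D h"
    unfolding mv_holomorphic_on_def by metis
  then show "\<exists>f'. ((\<lambda>c. f (c *s u)) has_field_derivative f') (at c)"
    using has_field_derivative_slice by blast
qed

lemma bounded_linear_cinner_left: "bounded_linear (\<lambda>z. cinner z v)"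
proof -
  have "linear (\<lambda>z. cinner z v)"
    by (intro linearI)
      (simp_all add: cinner_add_left cinner_scale_left scaleR_eq_cvec_scale scaleR_conv_of_real)
  then show ?thesis by (simp add: linear_conv_bounded_linear)
qed

text \<open>Restricting to the line through \<open>u\<close> and projecting onto \<open>v\<close>
  yields a self-map of the disc fixing 0: these are the hypotheses of the one-variable Schwarz
  lemma, plus the value of its derivative.\<close>

lemma ball_self_map_cinner_slice:
  assumes F: "ball_self_map F" and F0: "F 0 = 0" and u: "norm u = 1" and v: "norm v = 1"
  defines "g \<equiv> \<lambda>c. cinner (F (c *s u)) v"
  shows "g holomorphic_on ball 0 1" "g 0 = 0" "\<And>c. norm c < 1 \<Longrightarrow> norm (g c) < 1"
    "deriv g 0 = cinner (jacobian F (at 0) *v u) v"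
proof -
  have D: "((\<lambda>z. cinner (F z) v) has_derivative (\<lambda>h. cinner (jacobian F (at z) *v h) v)) (at z)"
    if "z \<in> unit_ball" for z
    by (rule bounded_linear.has_derivative[OF bounded_linear_cinner_left
          ball_self_map_has_derivative[OF F that]])
  have lin: "cinner (A *v (c *s h)) v = c * cinner (A *v h) v" for A c and h :: "complex^'a"
    by (simp add: vector_scalar_commute cinner_scale_left)
  show "g holomorphic_on ball 0 1"
    unfolding g_def
  proof (rule mv_holomorphic_slice)
    show "mv_holomorphic_on (\<lambda>z. cinner (F z) v) unit_ball"
      unfolding mv_holomorphic_on_def using D lin by blast
  qed (simp add: u)
  show "g 0 = 0" by (simp add: g_def F0 cinner_def)
  show "norm (g c) < 1" if "norm c < 1" for c
  proof -
    have "F (c *s u) \<in> unit_ball"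
      using that by (intro ball_self_mapD[OF F]) (simp add: norm_cvec_scale u)
    then show ?thesis
      using norm_cinner_le[of "F (c *s u)" v] by (simp add: g_def v)
  qed
  show "deriv g 0 = cinner (jacobian F (at 0) *v u) v"
    unfolding g_def
    by (rule DERIV_imp_deriv, rule has_field_derivative_slice) (use D[of 0] lin in auto)
qed

lemma unit_vector_decomposition:
  fixes z :: "complex^'n"
  obtains u where "norm u = 1" "z = of_real (norm z) *s u"
proof (cases "z = 0")
  case True
  \<comment> \<open>Any unit vector serves for \<open>z = 0\<close>.\<close>
  show ?thesis
    by (rule that[of "axis undefined 1"]) (simp_all add: True)
next
  case False
  have "norm (of_real (1 / norm z) *s z) = 1"
    unfolding norm_cvec_scale using False by (simp add: norm_divide)
  moreover have "z = of_real (norm z) *s (of_real (1 / norm z) *s z)"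
    using False by (simp add: vector_smult_assoc)
  ultimately show ?thesis by (rule that)
qed

text \<open>With \<open>u\<close> and \<open>v\<close> the directions of \<open>z\<close> and
  \<open>F z\<close>, the slice takes the value \<open>norm (F z)\<close> at
  \<open>norm z\<close>.\<close>

lemma ball_self_map_norm_le:
  assumes F: "ball_self_map F" and F0: "F 0 = 0" and z: "z \<in> unit_ball"
  shows "norm (F z) \<le> norm z"
proof -
  obtain u where u: "norm u = 1" "z = of_real (norm z) *s u"
    using unit_vector_decomposition by blast
  obtain v where v: "norm v = 1" "F z = of_real (norm (F z)) *s v"
    using unit_vector_decomposition by blast
  have "cinner (F z) v = of_real (norm (F z))"
    by (subst v(2)) (simp add: cinner_scale_left cinner_self v(1))
  moreover have "norm (cinner (F (of_real (norm z) *s u)) v) \<le> norm (complex_of_real (norm z))"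
    using Schwarz_Lemma(1)[OF ball_self_map_cinner_slice(1-3)[OF F F0 u(1) v(1)], of "of_real (norm z)"] z
    by simp
  ultimately show ?thesis using u(2) by simp
qed

text \<open>The derivative bound of the Schwarz lemma, with \<open>v\<close> the direction of the
  image of \<open>u\<close>.\<close>

lemma ball_self_map_jacobian_norm_le:
  assumes F: "ball_self_map F" and F0: "F 0 = 0"
  shows "norm (jacobian F (at 0) *v z) \<le> norm z"
proof -
  let ?A = "jacobian F (at 0)"
  obtain u where u: "norm u = 1" "z = of_real (norm z) *s u"
    using unit_vector_decomposition by blast
  obtain v where v: "norm v = 1" "?A *v u = of_real (norm (?A *v u)) *s v"
    using unit_vector_decomposition by blast
  have "cinner (?A *v u) v = of_real (norm (?A *v u))"
    by (subst v(2)) (simp add: cinner_scale_left cinner_self v(1))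
  moreover have "norm (cinner (?A *v u) v) \<le> 1"
    using Schwarz_Lemma(2)[OF ball_self_map_cinner_slice(1-3)[OF F F0 u(1) v(1)], of 0]
    unfolding ball_self_map_cinner_slice(4)[OF F F0 u(1) v(1)] by simp
  ultimately have "norm (?A *v u) \<le> 1" by simp
  moreover have "norm (?A *v z) = norm z * norm (?A *v u)"
    by (subst u(2)) (simp add: vector_scalar_commute norm_cvec_scale)
  ultimately show ?thesis by (simp add: mult_left_le)
qed

text \<open>The derivatives of \<open>F\<close> and \<open>G\<close> at 0 are both contractions and
  the second undoes the first, so the first is an isometry. On each complex line the equality case
  of the Schwarz lemma then forces \<open>F\<close> to be linear.\<close>

lemma ball_automorphism_fixing_0:
  assumes F: "ball_self_map F" and G: "ball_self_map G" and F0: "F 0 = 0"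
    and GF: "\<And>z. z \<in> unit_ball \<Longrightarrow> G (F z) = z"
  shows "norm (jacobian F (at 0) *v z) = norm z"
    and "z \<in> unit_ball \<Longrightarrow> F z = jacobian F (at 0) *v z"
proof -
  let ?A = "jacobian F (at 0)"
  have G0: "G 0 = 0" using GF[of 0] F0 by simp
  have iso: "norm (?A *v z) = norm z" for z
  proof (rule antisym)
    have "z = jacobian G (at 0) *v (?A *v z)"
      using jacobian_inverse[OF F G _ GF, of 0 z] F0 by simp
    then show "norm z \<le> norm (?A *v z)"
      using ball_self_map_jacobian_norm_le[OF G G0, of "?A *v z"] by simp
  qed (rule ball_self_map_jacobian_norm_le[OF F F0])
  show "norm (?A *v z) = norm z" by (rule iso)
  assume z: "z \<in> unit_ball"
  obtain u where u: "norm u = 1" "z = of_real (norm z) *s u"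
    using unit_vector_decomposition by blast
  define v where "v = ?A *v u"
  have v: "norm v = 1" by (simp add: v_def iso u(1))
  define g where "g c = cinner (F (c *s u)) v" for c
  note g = ball_self_map_cinner_slice[OF F F0 u(1) v, folded g_def]
  \<comment> \<open>A derivative of modulus 1 makes the slice linear, and its value 1 gives
    \<open>g c = c\<close>.\<close>
  have dg: "deriv g 0 = 1" using g(4) by (simp add: v_def[symmetric] cinner_self v)
  then obtain \<alpha> where \<alpha>: "\<And>c. norm c < 1 \<Longrightarrow> g c = \<alpha> * c"
    using Schwarz_Lemma(3)[OF g(1-3), of 0] by auto
  have "(g has_field_derivative \<alpha>) (at 0)"
    by (rule has_field_derivative_transform_within_open[of "\<lambda>c. \<alpha> * c" _ _ "ball 0 1"])
      (auto intro!: derivative_eq_intros simp: \<alpha>)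
  then have "\<alpha> = 1" using dg DERIV_imp_deriv by metis
  then have "cinner (F z) v = of_real (norm z)"
    using \<alpha>[of "of_real (norm z)"] z u(2) by (simp add: g_def)
  \<comment> \<open>The component of \<open>F z\<close> along \<open>v\<close> already has length
    \<open>norm z\<close>, and \<open>norm (F z)\<close> does not exceed this.\<close>
  then have "F z = of_real (norm z) *s v"
    using ball_self_map_norm_le[OF F F0 z] by (intro eq_scale_of_cinner_eq[OF v]) auto
  also have "\<dots> = ?A *v z"
    by (subst (2) u(2)) (simp add: v_def vector_scalar_commute)
  finally show "F z = ?A *v z" .
qed

text \<open>The usual formula \<open>(a - P z - s (z - P z)) / (1 - \<langle>z, a\<rangle>)\<close>, with \<open>P\<close> the orthogonal projection onto
  \<open>\<complex> a\<close> and \<open>s\<^sup>2 = 1 - |a|\<^sup>2\<close>, rewritten by means of \<open>(1 - s) / |a|\<^sup>2 = 1 / (1 + s)\<close> so that it also makes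
  sense for \<open>a = 0\<close>.\<close>

definition ball_involution :: "complex^'n \<Rightarrow> complex^'n \<Rightarrow> complex^'n"
  where "ball_involution a z = (let s = sqrt (1 - (norm a)\<^sup>2) in
    (1 / (1 - cinner z a)) *s (a - of_real s *s z - (cinner z a / of_real (1 + s)) *s a))"

text \<open>The image of \<open>z\<close> is \<open>N / (1 - x)\<close> with
  \<open>x = cinner z a\<close>. The ball is preserved because of the identity \<open>nN\<close>. A
  second application gives \<open>z\<close> because \<open>1 - cinner (ball_involution a z) a =
  \<sigma>\<^sup>2 / (1 - x)\<close>, so that the factors \<open>1 - x\<close> cancel.\<close>

lemma ball_involution_facts:
  fixes a z :: "complex^'n"
  assumes a: "a \<in> unit_ball" and z: "z \<in> unit_ball"
  shows "cinner z a \<noteq> 1" "norm (ball_involution a z) < 1" "ball_involution a (ball_involution a z) = z"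
proof -
  define s where "s = sqrt (1 - (norm a)\<^sup>2)"
  have na: "(norm a)\<^sup>2 < 1" using a by (simp add: power_less_one_iff abs_square_less_1)
  then have s: "s > 0" "s\<^sup>2 = 1 - (norm a)\<^sup>2" by (simp_all add: s_def)
  define \<sigma> where "\<sigma> = complex_of_real s"
  have \<sigma>: "\<sigma> \<noteq> 0" "1 + \<sigma> \<noteq> 0" "cnj \<sigma> = \<sigma>"
    using s(1) by (auto simp: \<sigma>_def complex_eq_iff)
  define x where "x = cinner z a"
  \<comment> \<open>Working with \<open>y\<close> instead of \<open>x\<close> removes the
    denominator \<open>1 + \<sigma>\<close> from the identities below.\<close>
  define y where "y = x / (1 + \<sigma>)"
  have y: "x = (1 + \<sigma>) * y" using \<sigma> by (simp add: y_def)
  define N where "N = (1 - y) *s a - \<sigma> *s z"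
  have nx: "norm x < 1"
    unfolding x_def using norm_cinner_le[of z a] a z
    by (smt (verit) dist_0_norm mem_ball mult_left_le norm_ge_zero)
  then have x: "1 - x \<noteq> 0" by auto
  then show "cinner z a \<noteq> 1" by (simp add: x_def)
  have m: "ball_involution a w = (1 / (1 - cinner w a)) *s (a - \<sigma> *s w - (cinner w a / (1 + \<sigma>)) *s a)" for w
    by (simp add: ball_involution_def Let_def s_def \<sigma>_def)
  have mz: "ball_involution a z = (1 / (1 - x)) *s N"
    by (simp add: m N_def y_def x_def vec_eq_iff algebra_simps)
  \<comment> \<open>The squared norm of \<open>a\<close> is \<open>1 - s\<^sup>2\<close>, factored
    so that \<open>1 + \<sigma>\<close> can be pulled out.\<close>
  have aa: "cinner a a = (1 + \<sigma>) * (1 - \<sigma>)"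
    unfolding cinner_self \<sigma>_def using s(2) by (simp add: complex_eq_iff algebra_simps power2_eq_square)
  have "cinner N N = (1 - y) * (1 - cnj y) * cinner a a - (1 - y) * \<sigma> * cnj x
      - \<sigma> * (1 - cnj y) * x + \<sigma>\<^sup>2 * cinner z z"
    unfolding N_def cinner_diff_left cinner_diff_right cinner_scale_left cinner_scale_right x_def
    using cinner_commute[of a z] \<sigma>(3) by (simp add: algebra_simps power2_eq_square)
  also have "\<dots> = (1 - x) * (1 - cnj x) - \<sigma>\<^sup>2 * (1 - cinner z z)"
    unfolding aa y by (simp add: \<sigma>(3) algebra_simps power2_eq_square)
  also have "(1 - x) * (1 - cnj x) = of_real ((norm (1 - x))\<^sup>2)"
    unfolding complex_norm_square by simp
  finally have "of_real ((norm N)\<^sup>2) = complex_of_real ((norm (1 - x))\<^sup>2 - s\<^sup>2 * (1 - (norm z)\<^sup>2))"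
    unfolding cinner_self by (simp add: \<sigma>_def)
  then have nN: "(norm N)\<^sup>2 = (norm (1 - x))\<^sup>2 - s\<^sup>2 * (1 - (norm z)\<^sup>2)"
    unfolding of_real_eq_iff .
  have "s\<^sup>2 * (1 - (norm z)\<^sup>2) > 0"
    using s(1) z by (simp add: abs_square_less_1)
  then have "(norm N)\<^sup>2 < (norm (1 - x))\<^sup>2"
    unfolding nN by linarith
  then have "norm N < norm (1 - x)"
    by (rule power_less_imp_less_base) simp
  then show "norm (ball_involution a z) < 1"
    using x by (simp add: mz norm_cvec_scale norm_divide)
  have "cinner N a = (1 + \<sigma>) * (1 - \<sigma> - y)"
    unfolding N_def cinner_diff_left cinner_scale_left aa x_def[symmetric] y by (simp add: algebra_simps)
  then have ma: "cinner (ball_involution a z) a = (1 + \<sigma>) * ((1 - \<sigma> - y) / (1 - x))"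
    by (simp add: mz cinner_scale_left)
  have "1 - cinner (ball_involution a z) a = ((1 - x) - (1 + \<sigma>) * (1 - \<sigma> - y)) / (1 - x)"
    unfolding ma using x by (simp add: diff_divide_distrib[of "1 - x"])
  also have "(1 - x) - (1 + \<sigma>) * (1 - \<sigma> - y) = \<sigma>\<^sup>2"
    unfolding y by (simp add: algebra_simps power2_eq_square)
  finally have ma': "1 - cinner (ball_involution a z) a = \<sigma>\<^sup>2 / (1 - x)" .
  have cancel: "(d / c) *s (a - (t / d) *s N - (q / d) *s a) = (1 / c) *s (d *s a - t *s N - q *s a)"
    if "d \<noteq> 0" for c d t q
    using that by simp
  have "ball_involution a (ball_involution a z) = ((1 - x) / \<sigma>\<^sup>2) *s
      (a - (\<sigma> / (1 - x)) *s N - ((1 - \<sigma> - y) / (1 - x)) *s a)"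
    \<comment> \<open>\<open>ma'\<close> rewrites the outer denominator as a whole, so it precedes
      \<open>ma\<close>; likewise \<open>ma\<close> precedes \<open>mz\<close>, which would destroy
      its left-hand side.\<close>
    unfolding m[of "ball_involution a z"] ma' unfolding ma unfolding mz using \<sigma>(2) by simp
  also have "\<dots> = (1 / \<sigma>\<^sup>2) *s ((1 - x) *s a - \<sigma> *s N - (1 - \<sigma> - y) *s a)"
    by (rule cancel[OF x])
  also have "(1 - x) *s a - \<sigma> *s N - (1 - \<sigma> - y) *s a = \<sigma>\<^sup>2 *s z"
    unfolding N_def y by (simp add: vec_eq_iff algebra_simps power2_eq_square)
  finally show "ball_involution a (ball_involution a z) = z"
    using \<sigma>(1) by (simp add: vector_smult_assoc)
qed

lemma ball_involution_0: "ball_involution a 0 = a"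
  by (simp add: ball_involution_def Let_def cinner_def)

lemma ball_self_map_ball_involution:
  fixes a :: "complex^'n"
  assumes a: "a \<in> unit_ball"
  shows "ball_self_map (ball_involution a)"
  unfolding ball_self_map_def holomorphic_map_on_def
proof (intro conjI allI)
  define s where "s = sqrt (1 - (norm a)\<^sup>2)"
  fix i
  \<comment> \<open>Each component is a quotient of two affine functions, written as
    \<open>k + L z\<close> to match \<open>mv_holomorphic_on_affine\<close>.\<close>
  have "mv_holomorphic_on (\<lambda>z :: complex^'n.
      (a $ i + (- of_real s * z $ i - (cinner z a / of_real (1 + s)) * a $ i)) /
      (1 + - cinner z a)) unit_ball"
  proof (intro mv_holomorphic_on_divide mv_holomorphic_on_affine)
    fix z :: "complex^'n" assume "z \<in> unit_ball"
    then show "1 + - cinner z a \<noteq> 0" using ball_involution_facts(1)[OF a] by auto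
  qed (simp_all add: cinner_add_left cinner_scale_left algebra_simps add_divide_distrib)
  moreover have "(\<lambda>z. ball_involution a z $ i) = (\<lambda>z.
      (a $ i + (- of_real s * z $ i - (cinner z a / of_real (1 + s)) * a $ i)) /
      (1 + - cinner z a))"
    by (simp add: fun_eq_iff ball_involution_def Let_def s_def diff_divide_distrib add_divide_distrib mult.commute)
  ultimately show "mv_holomorphic_on (\<lambda>z. ball_involution a z $ i) unit_ball" by simp
next
  show "ball_involution a ` unit_ball \<subseteq> unit_ball" using ball_involution_facts(2)[OF a] by auto
qed

text \<open>The derivative of \<open>H\<close> carries eigenvectors to eigenvectors, and the left
  inverse \<open>K\<close> keeps them nonzero. Applied in both directions with the involution as
  \<open>H\<close> and \<open>K\<close>, it gives equality of the spectra.\<close>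

lemma eigenvalues_jacobian_intertwine:
  assumes maps: "ball_self_map F" "ball_self_map G" "ball_self_map H" "ball_self_map K"
    and z: "z \<in> unit_ball" "G z = z"
    and eq: "\<And>x. x \<in> unit_ball \<Longrightarrow> F (H x) = H (G x)"
    and KH: "\<And>x. x \<in> unit_ball \<Longrightarrow> K (H x) = x"
  shows "eigenvalues (jacobian G (at z)) \<subseteq> eigenvalues (jacobian F (at (H z)))"
proof
  fix \<mu> assume "\<mu> \<in> eigenvalues (jacobian G (at z))"
  then obtain v where v: "v \<noteq> 0" "jacobian G (at z) *v v = \<mu> *s v"
    by (auto simp: eigenvalues_def)
  define w where "w = jacobian H (at z) *v v"
  have "w \<noteq> 0"
    using jacobian_inverse[OF maps(3,4) z(1) KH, of v] v(1) by (auto simp: w_def)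
  moreover have "jacobian F (at (H z)) *v w = \<mu> *s w"
    using jacobian_intertwine[OF maps(1-3) maps(3) z(1) eq, of v] z(2)
    by (simp add: w_def v(2) vector_scalar_commute)
  ultimately show "\<mu> \<in> eigenvalues (jacobian F (at (H z)))"
    by (auto simp: eigenvalues_def)
qed

text \<open>Conjugating by the involution moves the fixed point to 0, where the automorphism is a
  linear isometry. The relation is recorded for all iterates because these enter the means.\<close>

lemma automorphism_fixed_point_linearization:
  fixes \<phi> :: "complex^'n \<Rightarrow> complex^'n"
  assumes \<phi>: "ball_automorphism \<phi>" and a: "a \<in> unit_ball" "\<phi> a = a"
  obtains A where "\<And>z. norm (A *v z) = norm z"
    "eigenvalues (jacobian \<phi> (at a)) = eigenvalues A"
    "\<And>i z. z \<in> unit_ball \<Longrightarrow> (\<phi> ^^ i) (ball_involution a z) = ball_involution a (((*v) A ^^ i) z)"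
proof -
  define \<tau> where "\<tau> = ball_involution a"
  have \<tau>: "ball_self_map \<tau>" unfolding \<tau>_def by (rule ball_self_map_ball_involution[OF a(1)])
  have \<tau>\<tau>: "\<tau> (\<tau> z) = z" if "z \<in> unit_ball" for z
    unfolding \<tau>_def by (rule ball_involution_facts(3)[OF a(1) that])
  have \<tau>0: "\<tau> 0 = a" by (simp add: \<tau>_def ball_involution_0)
  then have \<tau>a: "\<tau> a = 0" using \<tau>\<tau>[of 0] by simp
  obtain \<eta> where \<phi>': "ball_self_map \<phi>" and \<eta>: "ball_self_map \<eta>"
    and \<eta>\<phi>: "\<And>z. z \<in> unit_ball \<Longrightarrow> \<eta> (\<phi> z) = z"
    using \<phi> unfolding ball_automorphism_def by blast
  define \<psi> where "\<psi> z = \<tau> (\<phi> (\<tau> z))" for z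
  note D = ball_self_mapD
  have \<psi>: "ball_self_map \<psi>"
    unfolding \<psi>_def[abs_def] by (rule ball_self_map_compose[OF ball_self_map_compose[OF \<tau> \<phi>'] \<tau>])
  have \<psi>0: "\<psi> 0 = 0" by (simp add: \<psi>_def \<tau>0 \<tau>a a(2))
  define A where "A = jacobian \<psi> (at 0)"
  have inv: "\<tau> (\<eta> (\<tau> (\<psi> z))) = z" if "z \<in> unit_ball" for z
    using that D[OF \<tau>] D[OF \<phi>'] by (simp add: \<psi>_def \<tau>\<tau> \<eta>\<phi>)
  have comp: "ball_self_map (\<lambda>z. \<tau> (\<eta> (\<tau> z)))"
    by (rule ball_self_map_compose[OF ball_self_map_compose[OF \<tau> \<eta>] \<tau>])
  have iso: "norm (A *v z) = norm z" for z
    unfolding A_def by (rule ball_automorphism_fixing_0(1)[OF \<psi> comp \<psi>0]) (rule inv)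
  have lin: "\<psi> z = A *v z" if "z \<in> unit_ball" for z
    unfolding A_def by (rule ball_automorphism_fixing_0(2)[OF \<psi> comp \<psi>0 _ that]) (rule inv)
  have \<phi>\<tau>: "\<phi> (\<tau> z) = \<tau> (\<psi> z)" if "z \<in> unit_ball" for z
    using that D[OF \<tau>] D[OF \<phi>'] by (simp add: \<psi>_def \<tau>\<tau>)
  have \<tau>\<phi>: "\<psi> (\<tau> z) = \<tau> (\<phi> z)" if "z \<in> unit_ball" for z
    using that by (simp add: \<psi>_def \<tau>\<tau>)
  \<comment> \<open>\<open>\<psi> z = A *v z\<close> is available on the ball, so the induction over
    iterates needs the orbit to stay there.\<close>
  have A_ball: "((*v) A ^^ i) z \<in> unit_ball" if "z \<in> unit_ball" for i z
    using that by (induction i) (simp_all add: iso)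
  show ?thesis
  proof (rule that[of A])
    show "norm (A *v z) = norm z" for z by (rule iso)
    show "eigenvalues (jacobian \<phi> (at a)) = eigenvalues A"
      using eigenvalues_jacobian_intertwine[OF \<phi>' \<psi> \<tau> \<tau> _ \<psi>0 \<phi>\<tau> \<tau>\<tau>]
        eigenvalues_jacobian_intertwine[OF \<psi> \<phi>' \<tau> \<tau> a \<tau>\<phi> \<tau>\<tau>]
      by (auto simp: A_def \<tau>0 \<tau>a)
    fix i and z :: "complex^'n" assume z: "z \<in> unit_ball"
    show "(\<phi> ^^ i) (ball_involution a z) = ball_involution a (((*v) A ^^ i) z)"
      unfolding \<tau>_def[symmetric]
    proof (induction i)
      case (Suc i)
      then show ?case using \<phi>\<tau>[OF A_ball[OF z]] lin[OF A_ball[OF z]] by simp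
    qed simp
  qed
qed

section \<open>Mean ergodicity\<close>

lemma blinfun_apply_funpow:
  fixes T :: "'a::real_normed_vector \<Rightarrow>\<^sub>L 'a"
  shows "blinfun_apply ((((o\<^sub>L) T) ^^ i) id_blinfun) f = (blinfun_apply T ^^ i) f"
  by (induction i) simp_all

lemma comp_operator_funpow_apply:
  assumes "ball_self_map \<phi>" "z \<in> unit_ball"
  shows "hinf_apply ((blinfun_apply (comp_operator \<phi>) ^^ i) f) z = hinf_apply f ((\<phi> ^^ i) z)"
  using assms(2)
proof (induction i arbitrary: z)
  case (Suc i)
  then show ?case
    using ball_self_mapD[OF assms(1) Suc.prems]
    by (simp add: comp_operator_apply[OF assms(1)] funpow_swap1[of \<phi>])
qed simp

lemma hinf_apply_sum: "hinf_apply (sum F I) z = (\<Sum>i\<in>I. hinf_apply (F i) z)"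
  by (induction I rule: infinite_finite_induct) (simp_all add: plus_hinf.rep_eq zero_hinf.rep_eq)

lemma cesaro_mean_comp_operator_apply:
  assumes "ball_self_map \<phi>" "z \<in> unit_ball"
  shows "hinf_apply (blinfun_apply (cesaro_mean j (comp_operator \<phi>)) f) z
       = (1 / of_nat j) * (\<Sum>i=1..j. hinf_apply f ((\<phi> ^^ i) z))"
  by (simp add: cesaro_mean_def blinfun.scaleR_left blinfun.sum_left blinfun_apply_funpow
      scaleR_hinf.rep_eq hinf_apply_sum comp_operator_funpow_apply[OF assms] scaleR_conv_of_real)

lemma uniformly_mean_ergodic_imp_mean_ergodic:
  fixes T :: "'a::real_normed_vector \<Rightarrow>\<^sub>L 'a"
  shows "uniformly_mean_ergodic T \<Longrightarrow> mean_ergodic T"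
  unfolding uniformly_mean_ergodic_def mean_ergodic_def convergent_def
proof (elim exE)
  fix P assume "(\<lambda>j. cesaro_mean j T) \<longlonglongrightarrow> P"
  then show "\<exists>P. \<forall>x. (\<lambda>j. blinfun_apply (cesaro_mean j T) x) \<longlonglongrightarrow> blinfun_apply P x"
    by (intro exI[of _ P] allI blinfun.tendsto tendsto_const)
qed

text \<open>Elements of \<open>hinf\<close> are determined by their values on the ball, so the
  operator powers are \<open>N\<close>-periodic and their means converge in operator norm.\<close>

lemma periodic_imp_uniformly_mean_ergodic:
  fixes \<phi> :: "complex^'n \<Rightarrow> complex^'n"
  assumes \<phi>: "ball_self_map \<phi>" and "N \<ge> 1" and per: "\<And>z. z \<in> unit_ball \<Longrightarrow> (\<phi> ^^ N) z = z"
  shows "uniformly_mean_ergodic (comp_operator \<phi>)"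
  unfolding uniformly_mean_ergodic_def cesaro_mean_def
proof (rule convergent_cesaro_of_periodic[OF \<open>N \<ge> 1\<close>])
  fix i
  show "(((o\<^sub>L) (comp_operator \<phi>)) ^^ (i + N)) id_blinfun = (((o\<^sub>L) (comp_operator \<phi>)) ^^ i) id_blinfun"
  proof (intro blinfun_eqI hinf_eqI)
    fix f and z :: "complex^'n" assume "z \<in> unit_ball"
    then show "hinf_apply (blinfun_apply ((((o\<^sub>L) (comp_operator \<phi>)) ^^ (i + N)) id_blinfun) f) z
        = hinf_apply (blinfun_apply ((((o\<^sub>L) (comp_operator \<phi>)) ^^ i) id_blinfun) f) z"
      unfolding blinfun_apply_funpow
      by (simp only: comp_operator_funpow_apply[OF \<phi>] funpow_add[where f = \<phi>] o_apply per)
  qed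
qed

text \<open>The function \<open>g\<close> on the disc is transplanted to the ball as
  \<open>f\<close>, so that on the embedded disc of points \<open>\<tau> (c *s v)\<close> the means
  of \<open>f\<close> are the rotation means of \<open>g\<close>. Norm convergence in
  \<open>hinf\<close> is uniform on the ball, hence on this disc.\<close>

lemma mean_ergodic_imp_eigenvalue_root_of_unity:
  fixes \<phi> :: "complex^'n \<Rightarrow> complex^'n"
  assumes \<phi>: "ball_self_map \<phi>" and a: "a \<in> unit_ball"
    and iso: "\<And>z. norm (A *v z) = norm z"
    and conj: "\<And>i z. z \<in> unit_ball \<Longrightarrow> (\<phi> ^^ i) (ball_involution a z) = ball_involution a (((*v) A ^^ i) z)"
    and me: "mean_ergodic (comp_operator \<phi>)" and l: "l \<in> eigenvalues A"
  shows "\<exists>m::nat. m \<ge> 1 \<and> l ^ m = 1"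
proof (rule ccontr)
  assume "\<not> ?thesis"
  then have irr: "\<forall>m::nat. m \<ge> 1 \<longrightarrow> l ^ m \<noteq> 1" by blast
  have nl: "norm l = 1" by (rule eigenvalues_isometry[OF iso l])
  obtain g where g: "g holomorphic_on ball 0 1" "\<forall>z\<in>ball 0 1. norm (g z) \<le> 1"
    and no_limit: "\<forall>p. p holomorphic_on ball 0 1 \<longrightarrow>
       \<not> uniform_limit (ball 0 1) (\<lambda>j z. (1 / of_nat j) * (\<Sum>i=1..j. g (l ^ i * z))) p sequentially"
    using irrational_rotation_not_mean_ergodic[OF nl irr] by (elim exE conjE)
  obtain w where w: "w \<noteq> 0" "A *v w = l *s w" using l by (auto simp: eigenvalues_def)
  define k where "k = complex_of_real (norm w)"
  obtain v where v: "norm v = 1" and kv: "w = k *s v"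
    unfolding k_def by (rule unit_vector_decomposition)
  have "k *s (A *v v) = k *s (l *s v)"
    using w(2) unfolding kv vector_scalar_commute by (simp add: vector_smult_assoc mult.commute)
  moreover have "k \<noteq> 0" using w(1) by (simp add: k_def)
  ultimately have Av: "A *v v = l *s v" by (metis vector_mul_lcancel)
  define \<tau> where "\<tau> = ball_involution a"
  have \<tau>: "ball_self_map \<tau>" unfolding \<tau>_def by (rule ball_self_map_ball_involution[OF a])
  have cv: "cinner z v \<in> ball 0 1" if "z \<in> unit_ball" for z
    using that norm_cinner_le[of z v] by (simp add: v)
  define q where "q z = g (cinner z v)" for z
  have "mv_holomorphic_on q unit_ball"
    unfolding mv_holomorphic_on_def
  proof
    fix z :: "complex^'n" assume "z \<in> unit_ball"
    then obtain g' where "(g has_field_derivative g') (at (cinner z v))"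
      using g(1) cv unfolding holomorphic_on_open[OF open_ball] by blast
    then have "(q has_derivative (\<lambda>h. g' * cinner h v)) (at z)"
      unfolding q_def[abs_def]
      using has_derivative_compose[OF bounded_linear_imp_has_derivative[OF bounded_linear_cinner_left]]
      unfolding has_field_derivative_def by blast
    then show "\<exists>D. (q has_derivative D) (at z) \<and> (\<forall>c h. D (c *s h) = c * D h)"
      by (intro exI[of _ "\<lambda>h. g' * cinner h v"]) (simp add: cinner_scale_left)
  qed
  note hol = mv_holomorphic_on_compose[OF this \<tau>]
  \<comment> \<open>Outside the ball the value 0 is required by the normalisation of
    \<open>hinf\<close>.\<close>
  define F where "F z = (if z \<in> unit_ball then q (\<tau> z) else 0)" for z
  have "bounded (F ` unit_ball)"
    unfolding bounded_iff F_def q_def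
    using g(2) cv ball_self_mapD[OF \<tau>] by (intro exI[of _ 1]) (auto simp del: mem_ball)
  then have "hinf_apply (Hinf F) = F"
    using hol by (intro Hinf_inverse) (auto simp: F_def[abs_def])
  then obtain f where f: "hinf_apply f = F" by blast
  obtain P where P: "(\<lambda>j. blinfun_apply (cesaro_mean j (comp_operator \<phi>)) f) \<longlonglongrightarrow> blinfun_apply P f"
    using me unfolding mean_ergodic_def by blast
  \<comment> \<open>The candidate limit on the disc is the restriction of \<open>P f\<close>,
    holomorphic because \<open>P f\<close> belongs to \<open>hinf\<close>.\<close>
  define p where "p c = hinf_apply (blinfun_apply P f) (\<tau> (c *s v))" for c
  have disc: "c *s v \<in> unit_ball" if "c \<in> ball 0 1" for c
    using that by (simp add: norm_cvec_scale v)
  have "p holomorphic_on ball 0 1"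
  proof (rule holomorphic_transform)
    show "(\<lambda>c. if c *s v \<in> unit_ball then hinf_apply (blinfun_apply P f) (\<tau> (c *s v)) else 0)
        holomorphic_on ball 0 1"
      by (rule mv_holomorphic_slice[OF mv_holomorphic_on_compose[OF mv_holomorphic_hinf_apply \<tau>]])
        (simp add: v)
  qed (use disc in \<open>auto simp: p_def\<close>)
  moreover have "uniform_limit (ball 0 1)
      (\<lambda>j c. (1 / of_nat j) * (\<Sum>i=1..j. g (l ^ i * c))) p sequentially"
  proof (rule uniform_limitI)
    fix e :: real assume "e > 0"
    have mean: "hinf_apply (blinfun_apply (cesaro_mean j (comp_operator \<phi>)) f) (\<tau> (c *s v))
        = (1 / of_nat j) * (\<Sum>i=1..j. g (l ^ i * c))" if c: "c \<in> ball 0 1" for j c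
    proof -
      \<comment> \<open>The involution contained in \<open>f\<close> undoes the outer
        \<open>\<tau>\<close>, and \<open>cinner\<close> against the unit vector \<open>v\<close>
        recovers the coordinate \<open>l ^ i * c\<close>.\<close>
      have "hinf_apply f ((\<phi> ^^ i) (\<tau> (c *s v))) = g (l ^ i * c)" for i
      proof -
        have b: "(l ^ i * c) *s v \<in> unit_ball"
          using c by (intro disc) (simp add: norm_mult norm_power nl)
        have "((*v) A ^^ i) (c *s v) = (l ^ i * c) *s v"
          by (simp add: funpow_matrix_scale funpow_matrix_eigenvector[OF Av] vector_smult_assoc mult.commute)
        then have "(\<phi> ^^ i) (\<tau> (c *s v)) = \<tau> ((l ^ i * c) *s v)"
          unfolding \<tau>_def using conj[OF disc[OF c]] by simp
        then show ?thesis
          using b ball_self_mapD[OF \<tau> b] ball_involution_facts(3)[OF a b]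
          by (simp add: f F_def q_def \<tau>_def cinner_scale_left cinner_self v del: mem_ball)
      qed
      then show ?thesis
        using cesaro_mean_comp_operator_apply[OF \<phi> ball_self_mapD[OF \<tau> disc[OF c]]] by simp
    qed
    from tendstoD[OF P \<open>e > 0\<close>]
    show "\<forall>\<^sub>F j in sequentially. \<forall>c\<in>ball 0 1.
        dist ((1 / of_nat j) * (\<Sum>i=1..j. g (l ^ i * c))) (p c) < e"
    proof eventually_elim
      case (elim j)
      show ?case
      proof
        fix c :: complex assume c: "c \<in> ball 0 1"
        let ?h = "blinfun_apply (cesaro_mean j (comp_operator \<phi>)) f - blinfun_apply P f"
        have "norm (hinf_apply ?h (\<tau> (c *s v))) \<le> norm ?h"
          by (rule norm_hinf_apply_le[OF ball_self_mapD[OF \<tau> disc[OF c]]])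
        also have "\<dots> < e" using elim by (simp add: dist_norm)
        finally show "dist ((1 / of_nat j) * (\<Sum>i=1..j. g (l ^ i * c))) (p c) < e"
          unfolding minus_hinf.rep_eq mean[OF c] by (simp add: dist_norm p_def)
      qed
    qed
  qed
  ultimately show False using no_limit by blast
qed

theorem theorem3p2:
  fixes \<phi> :: "complex^'n \<Rightarrow> complex^'n" and a :: "complex^'n"
  assumes "ball_automorphism \<phi>"
    and "a \<in> unit_ball" and "\<phi> a = a"
  shows "(mean_ergodic (comp_operator \<phi>) \<longleftrightarrow> uniformly_mean_ergodic (comp_operator \<phi>)) \<and>
    (uniformly_mean_ergodic (comp_operator \<phi>) \<longleftrightarrow>
      eigenvalues (jacobian \<phi> (at a)) \<subseteq>
        {\<mu> \<in> frontier (ball 0 1). \<exists>m::nat. m \<ge> 1 \<and> \<mu> ^ m = 1})"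
    (is "(?ME \<longleftrightarrow> ?UME) \<and> (_ \<longleftrightarrow> ?roots)")
proof -
  obtain A where A: "\<And>z. norm (A *v z) = norm z"
    "eigenvalues (jacobian \<phi> (at a)) = eigenvalues A"
    "\<And>i z. z \<in> unit_ball \<Longrightarrow> (\<phi> ^^ i) (ball_involution a z) = ball_involution a (((*v) A ^^ i) z)"
    using automorphism_fixed_point_linearization[OF assms] by blast
  have \<phi>: "ball_self_map \<phi>" using assms(1) by (simp add: ball_automorphism_def)
  have "?UME \<Longrightarrow> ?ME" by (rule uniformly_mean_ergodic_imp_mean_ergodic)
  moreover have "?roots" if ?ME
    unfolding A(2)
    using mean_ergodic_imp_eigenvalue_root_of_unity[OF \<phi> assms(2) A(1,3) that]
      eigenvalues_isometry[OF A(1)] by (auto simp: frontier_ball)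
  moreover have ?UME if ?roots
  proof -
    have "\<And>\<mu>. \<mu> \<in> eigenvalues A \<Longrightarrow> \<exists>m::nat. m \<ge> 1 \<and> \<mu> ^ m = 1"
      using that unfolding A(2) by blast
    then obtain N where N: "N \<ge> 1" "\<And>z. ((*v) A ^^ N) z = z"
      using isometry_periodic[OF A(1)] by blast
    \<comment> \<open>Each \<open>z\<close> in the ball is the image of
      \<open>ball_involution a z\<close> under the involution, so the period of \<open>A\<close>
      passes to \<open>\<phi>\<close>.\<close>
    have "(\<phi> ^^ N) z = z" if "z \<in> unit_ball" for z
    proof -
      have "ball_involution a z \<in> unit_ball"
        by (rule ball_self_mapD[OF ball_self_map_ball_involution[OF assms(2)] that])
      from A(3)[OF this, of N] show ?thesis
        by (simp only: N(2) ball_involution_facts(3)[OF assms(2) that])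
    qed
    then show ?thesis by (rule periodic_imp_uniformly_mean_ergodic[OF \<phi> N(1)])
  qed
  ultimately show ?thesis by blast
qed

end
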